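(* Let $p$ be a prime and $m\geq 1$ an integer. Let $E=\bigcup_{i=0}^{m-1}p^i\mathbb{Z}_p^\times$, viewed as a fundamental domain for the Tate curve $\mathbb{Q}_p^\ast/p^{m\mathbb{Z}}$, and let $D$ be the operator on locally constant functions on $E$ given by $$D\phi(x)=-c_p\int_E H(z,x)\big(\phi(z)-\phi(x)\big)\,d^\ast z,\qquad c_p=\frac{p(1-p^{-1})^2}{1-p^{-2}},$$ $$H(z,x)=\frac{|x|\,|z|}{|x-z|^2}+\frac{1}{p^m-1}\Big(\frac{|x|}{|z|}+\frac{|z|}{|x|}\Big).$$ For $x\in E$, $x\neq 1$, let $$h(x)=v(x-1)+\frac{v(x)(v(x)-m)}{2m}+\frac{m}{12}.$$ Define $G(x,y):=h(x/y)$ when $m-1\geq v(x)\geq v(y)\geq 0$ (with $x/y$ denoting the unique representative in $E$ of its class in $\mathbb{Q}_p^\ast/p^{m\mathbb{Z}}$), and extend by symmetry, $G(x,y)=G(y,x)$, to the case $v(x)<v(y)$. Then $G$ is, up to an additive constant, the unique symmetric Green's function for $D$, i.e. $D G(x,y)=\delta_{x,y}-\frac{1}{\mathrm{Vol}}$ (with $D$ acting in the variable $x$), where $\mathrm{Vol}=\frac{m(p-1)}{p}$ is the volume of $E$ with respect to $d^\ast x$.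
   Context: $v$ denotes the $p$-adic valuation and $|x|=p^{-v(x)}$. The additive Haar measure $dx$ on $\mathbb{Q}_p$ is normalized so that $\mathbb{Z}_p$ has measure $1$, and $d^\ast x=dx/|x|$ is the multiplicative Haar measure. Points of $E$ are identified with elements of $\mathbb{Q}_p^\ast/p^{m\mathbb{Z}}$; a product or quotient of elements of $E$ is understood as the representative in $E$ of the corresponding class. $\delta_{x,y}$ denotes the delta distribution at $y$ with respect to $d^\ast x$, acting on locally constant functions on $E$. $h$ is the Néron–Tate local height function on the Tate curve with parameter $q=p^m$. *)

theory Defs
  imports "HOL-Probability.Probability"
begin

text \<open>An element of Z_p is represented by its compatible system of residues
  x n \<in> {0..<p^n}, i.e. x n is x mod p^n.\<close>

definition Zp :: "nat \<Rightarrow> (nat \<Rightarrow> int) set" where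
  "Zp p = {f. \<forall>n. 0 \<le> f n \<and> f n < int p ^ n \<and> f (Suc n) mod int p ^ n = f n}"

definition zp_of_int :: "nat \<Rightarrow> int \<Rightarrow> (nat \<Rightarrow> int)" where
  "zp_of_int p a = (\<lambda>n. a mod int p ^ n)"

definition zp_sub :: "nat \<Rightarrow> (nat \<Rightarrow> int) \<Rightarrow> (nat \<Rightarrow> int) \<Rightarrow> (nat \<Rightarrow> int)" where
  "zp_sub p x y = (\<lambda>n. (x n - y n) mod int p ^ n)"

definition zp_mul :: "nat \<Rightarrow> (nat \<Rightarrow> int) \<Rightarrow> (nat \<Rightarrow> int) \<Rightarrow> (nat \<Rightarrow> int)" where
  "zp_mul p x y = (\<lambda>n. (x n * y n) mod int p ^ n)"

text \<open>p-adic valuation of a nonzero element (x n = 0 exactly for n \<le> v(x)).\<close>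
definition zp_val :: "nat \<Rightarrow> (nat \<Rightarrow> int) \<Rightarrow> nat" where
  "zp_val p x = (LEAST k. x (Suc k) \<noteq> 0)"

definition zp_abs :: "nat \<Rightarrow> (nat \<Rightarrow> int) \<Rightarrow> real" where
  "zp_abs p x = (if (\<forall>n. x n = 0) then 0 else real p powr (- real (zp_val p x)))"

text \<open>Quotient x/y in Z_p (used only when v(x) \<ge> v(y), where x/y already lies in E).\<close>
definition zp_div :: "nat \<Rightarrow> (nat \<Rightarrow> int) \<Rightarrow> (nat \<Rightarrow> int) \<Rightarrow> (nat \<Rightarrow> int)" where
  "zp_div p x y = (THE w. w \<in> Zp p \<and> zp_mul p w y = x)"

text \<open>Normalized additive Haar measure on Z_p: image of the product of uniform
  measures on the p-adic digits under the digit expansion.\<close>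
definition haar :: "nat \<Rightarrow> (nat \<Rightarrow> int) measure" where
  "haar p = distr (PiM UNIV (\<lambda>_::nat. uniform_count_measure {0..<int p}))
                  (PiM UNIV (\<lambda>_::nat. count_space (UNIV::int set)))
                  (\<lambda>d n. \<Sum>k<n. d k * int p ^ k)"

definition Edom :: "nat \<Rightarrow> nat \<Rightarrow> (nat \<Rightarrow> int) set" where
  "Edom p m = {x \<in> Zp p. (\<exists>n. x n \<noteq> 0) \<and> zp_val p x < m}"

text \<open>Multiplicative Haar measure d*x = dx/|x| restricted to E.\<close>
definition mstar :: "nat \<Rightarrow> nat \<Rightarrow> (nat \<Rightarrow> int) measure" where
  "mstar p m = density (restrict_space (haar p) (Edom p m))
                       (\<lambda>x. ennreal (real p ^ zp_val p x))"

definition volE :: "nat \<Rightarrow> nat \<Rightarrow> real" where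
  "volE p m = real m * (real p - 1) / real p"

definition cp :: "nat \<Rightarrow> real" where
  "cp p = real p * (1 - 1 / real p)\<^sup>2 / (1 - 1 / (real p)\<^sup>2)"

definition Hker :: "nat \<Rightarrow> nat \<Rightarrow> (nat \<Rightarrow> int) \<Rightarrow> (nat \<Rightarrow> int) \<Rightarrow> real" where
  "Hker p m z x =
     zp_abs p x * zp_abs p z / (zp_abs p (zp_sub p x z))\<^sup>2
     + 1 / (real p ^ m - 1) * (zp_abs p x / zp_abs p z + zp_abs p z / zp_abs p x)"

definition Dop :: "nat \<Rightarrow> nat \<Rightarrow> ((nat \<Rightarrow> int) \<Rightarrow> real) \<Rightarrow> (nat \<Rightarrow> int) \<Rightarrow> real" where
  "Dop p m \<phi> x = - cp p * (\<integral>z. Hker p m z x * (\<phi> z - \<phi> x) \<partial>mstar p m)"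

definition loc_const :: "nat \<Rightarrow> nat \<Rightarrow> ((nat \<Rightarrow> int) \<Rightarrow> real) \<Rightarrow> bool" where
  "loc_const p m \<phi> = (\<forall>x\<in>Edom p m. \<exists>n. \<forall>z\<in>Edom p m. z n = x n \<longrightarrow> \<phi> z = \<phi> x)"

definition hgt :: "nat \<Rightarrow> nat \<Rightarrow> (nat \<Rightarrow> int) \<Rightarrow> real" where
  "hgt p m x = real (zp_val p (zp_sub p x (zp_of_int p 1)))
     + real (zp_val p x) * (real (zp_val p x) - real m) / (2 * real m) + real m / 12"

definition Green :: "nat \<Rightarrow> nat \<Rightarrow> (nat \<Rightarrow> int) \<Rightarrow> (nat \<Rightarrow> int) \<Rightarrow> real" where
  "Green p m x y = (if zp_val p y \<le> zp_val p x then hgt p m (zp_div p x y)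
                    else hgt p m (zp_div p y x))"

text \<open>Weak (distributional) Green's function equation D_x g(x,y) = delta_y - 1/Vol.\<close>
definition is_green :: "nat \<Rightarrow> nat \<Rightarrow> ((nat \<Rightarrow> int) \<Rightarrow> (nat \<Rightarrow> int) \<Rightarrow> real) \<Rightarrow> bool" where
  "is_green p m g = (\<forall>y\<in>Edom p m. \<forall>\<phi>. loc_const p m \<phi> \<longrightarrow>
      integrable (mstar p m) (\<lambda>x. g x y * Dop p m \<phi> x) \<and>
      (\<integral>x. g x y * Dop p m \<phi> x \<partial>mstar p m)
        = \<phi> y - (1 / volE p m) * (\<integral>x. \<phi> x \<partial>mstar p m))"

end

theory Submission
  imports Defs "HOL-Number_Theory.Cong"
begin

text \<open>Multiplicative balls \<open>x(1 + p\<^sup>k Z\<^sub>p)\<close>, \<open>k \<ge> 1\<close>, all have \<open>d\<^sup>*x\<close>-volume \<open>p\<^sup>-\<^sup>k\<close>. Both \<open>H\<close> and \<open>G\<close>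
  are a function of \<open>v(x) - v(y)\<close> modulo \<open>m\<close> plus a combination of indicators of these balls, so their
  composition is computed ball by ball; the remaining convolution over \<open>Z/m\<close> is evaluated by
  summation by parts from second order recurrences. On functions of level \<open>N\<close> this identifies the
  average of \<open>G\<close> as the inverse of \<open>D\<close> modulo constants, and by compactness every locally constant
  function has a level. For uniqueness, every mean-zero combination of balls is in the range of \<open>D\<close>,
  so the difference of two Green's functions is almost everywhere constant in each
  variable separately, hence constant by symmetry and Fubini.\<close>

section \<open>Multiplicative balls in the p-adic integers\<close>

text \<open>The obstacle is the diagonal: \<open>Hker\<close> has a double pole there and
  \<open>Green\<close> a logarithmic one, so they cannot be composed directly. Functions of level N
  remove both. In \<open>Dop\<close> the factor \<open>\<phi> z - \<phi> x\<close> vanishes on the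
  ball where \<open>Hker\<close> and \<open>hN N\<close> may differ, so D becomes a bounded
  symmetric kernel minus multiplication by its mass \<open>rho N\<close>. Against such functions
  only the mean of \<open>Green\<close> over a ball matters: the terms \<open>ind k\<close> with k
  \<ge> N average to 1 + 1/P + 1/P^2 + ... = P/(P - 1) on the ball of level N, which is the last
  coefficient of \<open>gN\<close>. The constant \<open>cp\<close> is what turns the remaining
  multiple of a ball indicator into the indicator divided by the volume of the ball, the level N
  form of the delta distribution. For uniqueness, \<open>is_green\<close> gives integrability only
  after multiplication by \<open>Dop p m \<phi>\<close>; integrability of the difference itself is
  recovered by dividing by an element of the range of D that never vanishes.\<close>

lemma measurable_countable_binop:
  fixes f :: "'a \<Rightarrow> 'b :: countable" and g :: "'a \<Rightarrow> 'c :: countable"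
  assumes "f \<in> M \<rightarrow>\<^sub>M count_space UNIV" "g \<in> M \<rightarrow>\<^sub>M count_space UNIV"
  shows "(\<lambda>x. h (f x) (g x)) \<in> M \<rightarrow>\<^sub>M count_space UNIV"
proof (rule measurable_compose_countable[OF _ assms(1), where f = "\<lambda>i x. h i (g x)"])
  fix i
  show "(\<lambda>x. h i (g x)) \<in> M \<rightarrow>\<^sub>M count_space UNIV"
    by (rule measurable_compose[OF assms(2)]) simp
qed

locale tate =
  fixes p m :: nat
  assumes prime_p: "prime p" and m_pos: "m \<ge> 1"
begin

abbreviation "E \<equiv> Edom p m"
abbreviation "v \<equiv> zp_val p"
abbreviation "P \<equiv> real p"
abbreviation "\<mu> \<equiv> mstar p m"

lemma p_gt_1: "p > 1"
  using prime_p prime_gt_1_nat by blast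

lemma P_gt_1: "P > 1"
  using p_gt_1 by simp

lemma P_pm_gt_1: "P ^ m > 1"
  using P_gt_1 m_pos by (intro one_less_power) auto

lemma Zp_bounds: "x \<in> Zp p \<Longrightarrow> 0 \<le> x n" "x \<in> Zp p \<Longrightarrow> x n < int p ^ n"
  by (auto simp: Zp_def)

lemma Zp_mod:
  assumes "x \<in> Zp p" "n \<le> N"
  shows "x N mod int p ^ n = x n"
  using assms(2)
proof (induction N rule: dec_induct)
  case base
  then show ?case using assms(1) by (simp add: Zp_bounds)
next
  case (step N)
  have "x (Suc N) mod int p ^ N = x N" using assms(1) by (simp add: Zp_def)
  moreover have "x (Suc N) mod int p ^ N mod int p ^ n = x (Suc N) mod int p ^ n"
    using step.hyps by (intro mod_mod_cancel le_imp_power_dvd) simp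
  ultimately show ?case using step.IH by simp
qed

lemma Zp_eq_mono: "x \<in> Zp p \<Longrightarrow> z \<in> Zp p \<Longrightarrow> x N = z N \<Longrightarrow> n \<le> N \<Longrightarrow> x n = z n"
  by (metis Zp_mod)

lemma Zp_at_0: "x \<in> Zp p \<Longrightarrow> x 0 = 0"
  using Zp_bounds[of x 0] by simp

text \<open>The zero residues form an initial segment, which contains 0 because the modulus p^0 is
  1. Hence the \<open>LEAST\<close> over \<open>Suc k\<close> in \<open>zp_val\<close> marks the end
  of that segment.\<close>

lemma Zp_zero_iff:
  assumes "x \<in> Zp p" "\<exists>n. x n \<noteq> 0"
  shows "x n = 0 \<longleftrightarrow> n \<le> v x"
proof -
  have mono: "x k = 0" if "x n = 0" "k \<le> n" for k n
    using Zp_mod[OF assms(1) that(2)] that(1) by simp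
  obtain n0 where n0: "x n0 \<noteq> 0" using assms(2) by blast
  then have "n0 \<noteq> 0" using Zp_at_0[OF assms(1)] by metis
  then have "x (Suc (n0 - 1)) \<noteq> 0" using n0 by simp
  then have nz: "x (Suc (v x)) \<noteq> 0"
    unfolding zp_val_def by (rule LeastI)
  have z: "x (v x) = 0"
  proof (cases "v x")
    case 0
    then show ?thesis using Zp_at_0[OF assms(1)] by simp
  next
    case (Suc k)
    then have "\<not> x (Suc k) \<noteq> 0"
      unfolding zp_val_def by (intro not_less_Least) simp
    then show ?thesis using Suc by simp
  qed
  show ?thesis
    using mono[OF z, of n] mono[of n "Suc (v x)"] nz by (metis not_less_eq_eq)
qed

lemma E_Zp: "x \<in> E \<Longrightarrow> x \<in> Zp p"
  and E_val: "x \<in> E \<Longrightarrow> v x < m"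
  and E_zero_iff: "x \<in> E \<Longrightarrow> x n = 0 \<longleftrightarrow> n \<le> v x"
  using Zp_zero_iff by (auto simp: Edom_def)

lemma E_I: "x \<in> Zp p \<Longrightarrow> x m \<noteq> 0 \<Longrightarrow> x \<in> E"
  using Zp_zero_iff[of x m] by (force simp: Edom_def)

lemma E_val_eqI: "x \<in> E \<Longrightarrow> x n = 0 \<Longrightarrow> x (Suc n) \<noteq> 0 \<Longrightarrow> v x = n"
  by (simp add: E_zero_iff)

text \<open>For \<open>k \<ge> 1\<close> the relation \<open>rel k x z\<close> says \<open>z \<in> x(1 + p\<^sup>k Z\<^sub>p)\<close>.
  These multiplicative balls all have \<open>d\<^sup>*x\<close>-volume \<open>p\<^sup>-\<^sup>k\<close>.\<close>

definition rel :: "nat \<Rightarrow> (nat \<Rightarrow> int) \<Rightarrow> (nat \<Rightarrow> int) \<Rightarrow> bool" where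
  "rel k x z \<longleftrightarrow> v x = v z \<and> x (v x + k) = z (v x + k)"

lemma rel_refl [simp]: "rel k x x"
  by (simp add: rel_def)

lemma rel_sym: "rel k x z \<longleftrightarrow> rel k z x"
  by (auto simp: rel_def)

lemma rel_trans: "rel k x y \<Longrightarrow> rel k y z \<Longrightarrow> rel k x z"
  by (auto simp: rel_def)

lemma rel_mono: "rel N x z \<Longrightarrow> k \<le> N \<Longrightarrow> x \<in> E \<Longrightarrow> z \<in> E \<Longrightarrow> rel k x z"
  using Zp_eq_mono[of x z "v x + N" "v x + k"] by (auto simp: rel_def E_Zp)

lemma rel_coord: "rel n x z \<Longrightarrow> x \<in> E \<Longrightarrow> z \<in> E \<Longrightarrow> x n = z n"
  using Zp_eq_mono[of x z "v x + n" n] by (auto simp: rel_def E_Zp)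

text \<open>One digit beyond the valuation fixes the valuation itself: the residue is 0 at
  \<open>v x\<close> and nonzero at \<open>Suc (v x)\<close>. For k = 0 the residue at
  \<open>v x\<close> would only give v x \<le> v z.\<close>

lemma rel_iff_eq:
  assumes "x \<in> E" "z \<in> E" "k \<ge> 1"
  shows "rel k x z \<longleftrightarrow> x (v x + k) = z (v x + k)"
proof
  assume eq: "x (v x + k) = z (v x + k)"
  have that: "x n = z n" if "n \<le> Suc (v x)" for n
    using Zp_eq_mono[of x z "v x + k" n] eq assms that by (auto simp: E_Zp)
  have "v z = v x"
  proof -
    have "z (v x) = 0" using that[of "v x"] E_zero_iff[OF assms(1), of "v x"] by simp
    moreover have "z (Suc (v x)) \<noteq> 0"
      using that[of "Suc (v x)"] E_zero_iff[OF assms(1), of "Suc (v x)"] by simp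
    ultimately show ?thesis using E_val_eqI[OF assms(2)] by blast
  qed
  then show "rel k x z" using eq by (simp add: rel_def)
qed (unfold rel_def, blast)

lemma rel_all_imp_eq:
  assumes "x \<in> E" "z \<in> E" "\<And>k. rel k x z"
  shows "x = z"
  using rel_coord[OF assms(3) assms(1,2)] by auto

text \<open>\<open>prox x z\<close> is the largest \<open>k\<close> with \<open>rel k x z\<close> for \<open>x\<close>, \<open>z\<close> of equal valuation, and
  \<open>0\<close> for different valuations; for \<open>x = z\<close> it is an unspecified constant.\<close>

definition prox :: "(nat \<Rightarrow> int) \<Rightarrow> (nat \<Rightarrow> int) \<Rightarrow> nat" where
  "prox x z = (LEAST k. \<not> rel (Suc k) x z)"

lemma prox_sym: "prox x z = prox z x"
  unfolding prox_def by (subst rel_sym) simp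

text \<open>Distinct points are separated by some ball and balls are nested, so the
  \<open>LEAST\<close> is attained. The bound k \<ge> 1 matters: points on different shells have
  \<open>prox\<close> 0 but fail \<open>rel 0\<close>.\<close>

lemma rel_iff_prox:
  assumes "x \<in> E" "z \<in> E" "x \<noteq> z" "k \<ge> 1"
  shows "rel k x z \<longleftrightarrow> k \<le> prox x z"
proof -
  obtain j where j: "\<not> rel j x z" using rel_all_imp_eq assms by blast
  then have "\<not> rel (Suc j) x z" using rel_mono assms by (meson le_SucI order_refl)
  then have nr: "\<not> rel (Suc (prox x z)) x z" unfolding prox_def by (rule LeastI)
  show ?thesis
  proof
    assume "rel k x z"
    then show "k \<le> prox x z"
      using nr rel_mono assms by (metis not_less_eq_eq)
  next
    assume k: "k \<le> prox x z"
    then have "k - 1 < prox x z" using assms by linarith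
    then have "\<not> \<not> rel (Suc (k-1)) x z"
      unfolding prox_def by (rule not_less_Least)
    then show "rel k x z" using assms by simp
  qed
qed

section \<open>Valuations of differences\<close>

lemma zp_sub_zero_iff:
  assumes "x \<in> Zp p" "z \<in> Zp p"
  shows "zp_sub p x z n = 0 \<longleftrightarrow> x n = z n"
proof -
  have "(x n - z n) mod int p ^ n = 0 \<longleftrightarrow> x n mod int p ^ n = z n mod int p ^ n"
    by (simp add: mod_eq_dvd_iff dvd_eq_mod_eq_0)
  then show ?thesis
    by (simp add: zp_sub_def Zp_bounds[OF assms(1)] Zp_bounds[OF assms(2)])
qed

lemma zp_val_sub:
  assumes "x \<in> Zp p" "z \<in> Zp p"
  shows "v (zp_sub p x z) = (LEAST k. x (Suc k) \<noteq> z (Suc k))"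
  using zp_sub_zero_iff[OF assms] by (simp add: zp_val_def)

lemma zp_val_sub_eqI:
  assumes "x \<in> Zp p" "z \<in> Zp p" "x n = z n" "x (Suc n) \<noteq> z (Suc n)"
  shows "v (zp_sub p x z) = n"
  unfolding zp_val_sub[OF assms(1,2)]
proof (rule Least_equality)
  fix k assume "x (Suc k) \<noteq> z (Suc k)"
  then show "n \<le> k" using Zp_eq_mono[OF assms(1-3), of "Suc k"] by fastforce
qed (fact assms)

lemma zp_sub_nonzero: "x \<in> Zp p \<Longrightarrow> z \<in> Zp p \<Longrightarrow> x \<noteq> z \<Longrightarrow> \<exists>n. zp_sub p x z n \<noteq> 0"
  using zp_sub_zero_iff by blast

lemma zp_val_sub_diff:
  assumes "x \<in> E" "z \<in> E" "v x < v z"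
  shows "v (zp_sub p x z) = v x"
proof (rule zp_val_sub_eqI)
  have "x (v x) = 0" "z (v x) = 0" "x (Suc (v x)) \<noteq> 0" "z (Suc (v x)) = 0"
    using assms by (simp_all add: E_zero_iff Suc_le_eq)
  then show "x (v x) = z (v x)" "x (Suc (v x)) \<noteq> z (Suc (v x))" by simp_all
qed (use assms in \<open>auto simp: E_Zp\<close>)

lemma zp_sub_val_sym: "x \<in> Zp p \<Longrightarrow> z \<in> Zp p \<Longrightarrow> v (zp_sub p x z) = v (zp_sub p z x)"
  by (simp add: zp_val_sub eq_commute)

text \<open>\<open>prox x z\<close> is the valuation of 1 - z/x, so factoring x out of x - z adds
  \<open>v x\<close>.\<close>

lemma zp_val_sub_same:
  assumes "x \<in> E" "z \<in> E" "v x = v z" "x \<noteq> z"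
  shows "v (zp_sub p x z) = v x + prox x z"
proof (rule zp_val_sub_eqI)
  have prox: "x (v x + k) = z (v x + k) \<longleftrightarrow> k \<le> prox x z" if "k \<ge> 1" for k
    using rel_iff_prox[OF assms(1,2,4) that] assms(3) by (simp add: rel_def)
  have "x (v x) = 0" "z (v x) = 0" using assms by (simp_all add: E_zero_iff)
  then have "x (v x) = z (v x)" by simp
  then show "x (v x + prox x z) = z (v x + prox x z)"
    using prox[of "prox x z"] by (cases "prox x z") auto
  show "x (Suc (v x + prox x z)) \<noteq> z (Suc (v x + prox x z))"
    using prox[of "Suc (prox x z)"] by simp
qed (use assms in \<open>auto simp: E_Zp\<close>)

section \<open>Division and the Green function\<close>

lemma zp_of_int_Zp: "zp_of_int p a \<in> Zp p"
proof -
  have "a mod int p ^ Suc n mod int p ^ n = a mod int p ^ n" for n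
    by (intro mod_mod_cancel) simp
  then show ?thesis using p_gt_1 by (simp add: Zp_def zp_of_int_def)
qed

text \<open>Dividing by p^b costs b digits, hence the index n + b: the quotient represents x/p^b
  modulo p^n.\<close>

lemma E_factor:
  assumes "x \<in> E" "b \<le> v x"
  shows "x (n + b) = int p ^ b * (x (n + b) div int p ^ b)"
proof -
  have "x (n + b) mod int p ^ b = x b" using Zp_mod[OF E_Zp[OF assms(1)], of b "n + b"] by simp
  also have "\<dots> = 0" using assms E_zero_iff by simp
  finally show ?thesis by (simp add: mod_eq_0_iff_dvd)
qed

lemma cong_shift: "[int p ^ b * s = int p ^ b * t] (mod int p ^ (n + b)) \<longleftrightarrow> [s = t] (mod int p ^ n)"
  using p_gt_1 by (simp add: cong_def power_add mult.commute[of _ "int p ^ b"] mult_mod_right[symmetric])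

lemma Zp_cong: "x \<in> Zp p \<Longrightarrow> n \<le> N \<Longrightarrow> [x N = x n] (mod int p ^ n)"
  by (simp add: cong_def Zp_mod Zp_bounds)

lemma Zp_eq_iff_cong: "x \<in> Zp p \<Longrightarrow> y \<in> Zp p \<Longrightarrow> x n = y n \<longleftrightarrow> [x n = y n] (mod int p ^ n)"
  by (simp add: cong_def Zp_bounds)

lemma unit_part_coprime:
  assumes "y \<in> E"
  shows "coprime (y (n + v y) div int p ^ v y) (int p ^ n)"
proof (cases n)
  case (Suc k)
  have "\<not> int p dvd y (n + v y) div int p ^ v y"
  proof
    assume "int p dvd y (n + v y) div int p ^ v y"
    then have "int p ^ v y * int p dvd int p ^ v y * (y (n + v y) div int p ^ v y)"
      by (intro mult_dvd_mono) auto
    then have "int p ^ Suc (v y) dvd y (n + v y)"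
      using E_factor[OF assms order_refl, of n] by (simp add: mult.commute)
    then have "y (Suc (v y)) = 0"
      using Zp_mod[OF E_Zp[OF assms], of "Suc (v y)" "n + v y"] Suc by (simp add: mod_eq_0_iff_dvd)
    then show False using E_zero_iff[OF assms] by simp
  qed
  then have "coprime (int p) (y (n + v y) div int p ^ v y)"
    using prime_p by (intro prime_imp_coprime) auto
  then show ?thesis by (simp add: coprime_commute)
qed simp

text \<open>Multiplication by y is not invertible modulo p^n when p divides y; cancelling p^(v y)
  leaves the unit part, which is invertible. The price is the index shift by
  \<open>v y\<close>.\<close>

lemma zp_mul_eq_iff:
  assumes "x \<in> E" "y \<in> E" "v y \<le> v x" "w \<in> Zp p"
  shows "zp_mul p w y = x \<longleftrightarrow>
    (\<forall>n. [w n * (y (n + v y) div int p ^ v y) = x (n + v y) div int p ^ v y] (mod int p ^ n))"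
    (is "_ \<longleftrightarrow> (\<forall>n. [w n * ?u n = ?t n] (mod _))")
proof -
  note y = E_factor[OF assms(2) order_refl] and x = E_factor[OF assms(1,3)]
  have 1: "zp_mul p w y = x \<longleftrightarrow> (\<forall>n. [w n * y n = x n] (mod int p ^ n))"
    by (auto simp: zp_mul_def fun_eq_iff cong_def Zp_bounds E_Zp assms)
  have 2: "[w n * ?u n = ?t n] (mod int p ^ n) \<longleftrightarrow>
      [w (n + v y) * y (n + v y) = x (n + v y)] (mod int p ^ (n + v y))" for n
  proof -
    have "[w n * ?u n = ?t n] (mod int p ^ n) \<longleftrightarrow> [w (n + v y) * ?u n = ?t n] (mod int p ^ n)"
      using Zp_cong[OF assms(4), of n "n + v y"]
      by (meson cong_scalar_right cong_sym cong_trans le_add1)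
    also have "\<dots> \<longleftrightarrow> [int p ^ v y * (w (n + v y) * ?u n) = int p ^ v y * ?t n] (mod int p ^ (n + v y))"
      by (rule cong_shift[symmetric])
    also have "int p ^ v y * (w (n + v y) * ?u n) = w (n + v y) * y (n + v y)"
      using y[of n] by (simp add: mult.left_commute)
    also have "int p ^ v y * ?t n = x (n + v y)"
      using x[of n] by simp
    finally show ?thesis .
  qed
  \<comment> \<open>\<open>2\<close> only reaches the moduli p^(n + v y); reduction supplies the
    equation of \<open>1\<close> at the smaller ones.\<close>
  have 3: "[w n * y n = x n] (mod int p ^ n)"
    if "[w (n + v y) * y (n + v y) = x (n + v y)] (mod int p ^ (n + v y))" for n
  proof -
    have "[w (n + v y) * y (n + v y) = x (n + v y)] (mod int p ^ n)"
      using that by (rule cong_dvd_modulus) (simp add: le_imp_power_dvd)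
    moreover have "[w (n + v y) * y (n + v y) = w n * y n] (mod int p ^ n)"
      using assms by (intro cong_mult Zp_cong) (auto simp: E_Zp)
    moreover have "[x (n + v y) = x n] (mod int p ^ n)"
      using assms by (intro Zp_cong) (auto simp: E_Zp)
    ultimately show ?thesis by (meson cong_sym cong_trans)
  qed
  show ?thesis unfolding 1 2 using 3 by blast
qed

text \<open>At each level the unit part of y has an inverse, which gives the residue of the
  quotient. Cancelling that unit proves both that the residues are compatible and that they are
  unique.\<close>

lemma zp_div_ex1:
  assumes "x \<in> E" "y \<in> E" "v y \<le> v x"
  shows "\<exists>!w. w \<in> Zp p \<and> zp_mul p w y = x"
proof -
  define u t where "u n = y (n + v y) div int p ^ v y" and "t n = x (n + v y) div int p ^ v y" for n
  have cop: "coprime (u n) (int p ^ n)" for n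
    unfolding u_def by (rule unit_part_coprime[OF assms(2)])
  have iff: "zp_mul p w y = x \<longleftrightarrow> (\<forall>n. [w n * u n = t n] (mod int p ^ n))" if "w \<in> Zp p" for w
    unfolding u_def t_def by (rule zp_mul_eq_iff[OF assms that])
  have u_Suc: "[u (Suc n) = u n] (mod int p ^ n)" for n
  proof -
    have "[y (Suc n + v y) = y (n + v y)] (mod int p ^ (n + v y))"
      by (intro Zp_cong E_Zp assms) simp
    then show ?thesis
      using E_factor[OF assms(2) order_refl, of n] E_factor[OF assms(2) order_refl, of "Suc n"]
      by (metis cong_shift u_def)
  qed
  have t_Suc: "[t (Suc n) = t n] (mod int p ^ n)" for n
  proof -
    have "[x (Suc n + v y) = x (n + v y)] (mod int p ^ (n + v y))"
      by (intro Zp_cong E_Zp assms) simp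
    then show ?thesis
      using E_factor[OF assms(1,3), of n] E_factor[OF assms(1,3), of "Suc n"]
      by (metis cong_shift t_def)
  qed
  have "\<exists>i. [u n * i = 1] (mod int p ^ n)" for n
    using cop[of n] by (rule cong_solve_coprime_int)
  then obtain i where i: "[u n * i n = 1] (mod int p ^ n)" for n by metis
  define w where "w n = (t n * i n) mod int p ^ n" for n
  have w: "[w n * u n = t n] (mod int p ^ n)" for n
  proof -
    have "[w n * u n = t n * i n * u n] (mod int p ^ n)"
      by (intro cong_mult) (simp_all add: w_def cong_def)
    also have "t n * i n * u n = t n * (u n * i n)" by (simp add: algebra_simps)
    also have "[\<dots> = t n * 1] (mod int p ^ n)"
      by (intro cong_mult i) simp
    finally show ?thesis by simp
  qed
  have "w (Suc n) mod int p ^ n = w n" for n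
  proof -
    have "[w (Suc n) * u (Suc n) = t (Suc n)] (mod int p ^ n)"
      using w[of "Suc n"] by (rule cong_dvd_modulus) simp
    then have "[w (Suc n) * u n = w n * u n] (mod int p ^ n)"
      using u_Suc[of n] t_Suc[of n] w[of n]
      by (meson cong_mult cong_refl cong_sym cong_trans)
    then have "[w (Suc n) = w n] (mod int p ^ n)"
      using cong_mult_rcancel[OF cop] by blast
    then show ?thesis by (simp add: cong_def w_def)
  qed
  then have wZ: "w \<in> Zp p"
    using p_gt_1 by (auto simp: Zp_def w_def)
  show ?thesis
  proof (rule ex1I[of _ w])
    show "w \<in> Zp p \<and> zp_mul p w y = x" using wZ iff[OF wZ] w by simp
    fix w' assume w': "w' \<in> Zp p \<and> zp_mul p w' y = x"
    then have "[w' n * u n = w n * u n] (mod int p ^ n)" for n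
      using iff[of w'] w[of n] by (meson cong_sym cong_trans)
    then have "[w' n = w n] (mod int p ^ n)" for n
      using cong_mult_rcancel[OF cop] by blast
    then show "w' = w"
      using w' wZ Zp_eq_iff_cong by blast
  qed
qed

text \<open>Comparison with 0 and with 1 is all that \<open>hgt\<close> asks of the quotient: v(x/y)
  and v(x/y - 1) are read off from it. Both cases come from one congruence with a parameter
  c.\<close>

lemma zp_div_facts:
  assumes "x \<in> E" "y \<in> E" "v y \<le> v x"
  shows zp_div_Zp: "zp_div p x y \<in> Zp p"
    and zp_div_zero_iff: "zp_div p x y n = 0 \<longleftrightarrow> x (n + v y) = 0"
    and zp_div_one_iff: "zp_div p x y n = zp_of_int p 1 n \<longleftrightarrow> x (n + v y) = y (n + v y)"
proof -
  let ?w = "zp_div p x y"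
  let ?u = "\<lambda>n. y (n + v y) div int p ^ v y" and ?t = "\<lambda>n. x (n + v y) div int p ^ v y"
  have w: "?w \<in> Zp p \<and> zp_mul p ?w y = x"
    unfolding zp_div_def by (rule theI'[OF zp_div_ex1[OF assms]])
  then show wZ: "?w \<in> Zp p" by simp
  have eq: "[?w n * ?u n = ?t n] (mod int p ^ n)"
    using w zp_mul_eq_iff[OF assms wZ] by simp
  note y = E_factor[OF assms(2) order_refl, of n] and x = E_factor[OF assms(1,3), of n]
  have cop: "coprime (?u n) (int p ^ n)"
    by (rule unit_part_coprime[OF assms(2)])
  have *: "[?w n = c] (mod int p ^ n) \<longleftrightarrow> [x (n + v y) = c * y (n + v y)] (mod int p ^ (n + v y))" for c
  proof -
    have "[?w n = c] (mod int p ^ n) \<longleftrightarrow> [?w n * ?u n = c * ?u n] (mod int p ^ n)"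
      using cong_mult_rcancel[OF cop] by blast
    also have "\<dots> \<longleftrightarrow> [?t n = c * ?u n] (mod int p ^ n)"
      using eq by (meson cong_sym cong_trans)
    also have "\<dots> \<longleftrightarrow> [int p ^ v y * ?t n = int p ^ v y * (c * ?u n)] (mod int p ^ (n + v y))"
      by (rule cong_shift[symmetric])
    also have "int p ^ v y * ?t n = x (n + v y)" using x by simp
    also have "int p ^ v y * (c * ?u n) = c * y (n + v y)"
      using y by (simp add: mult.left_commute)
    finally show ?thesis .
  qed
  show "?w n = 0 \<longleftrightarrow> x (n + v y) = 0"
    using *[of 0] by (simp add: cong_def Zp_bounds[OF wZ] Zp_bounds[OF E_Zp[OF assms(1)]])
  have "?w n = zp_of_int p 1 n \<longleftrightarrow> [?w n = 1] (mod int p ^ n)"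
    by (simp add: cong_def Zp_bounds[OF wZ] zp_of_int_def)
  also have "\<dots> \<longleftrightarrow> x (n + v y) = y (n + v y)"
    unfolding * using Zp_eq_iff_cong[OF E_Zp[OF assms(1)] E_Zp[OF assms(2)]] by simp
  finally show "?w n = zp_of_int p 1 n \<longleftrightarrow> x (n + v y) = y (n + v y)" .
qed

lemma zp_val_div:
  assumes "x \<in> E" "y \<in> E" "v y \<le> v x"
  shows "v (zp_div p x y) = v x - v y"
  unfolding zp_val_def[of p "zp_div p x y"]
  by (rule Least_equality) (use assms in \<open>auto simp: zp_div_zero_iff E_zero_iff\<close>)

text \<open>The \<open>LEAST\<close> predicates on both sides agree for every k. This includes x =
  y, where both are empty and both sides are the same unspecified number, so that
  \<open>Green_eq\<close> holds on the diagonal too.\<close>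

lemma zp_val_div_sub_one:
  assumes "x \<in> E" "y \<in> E" "v y \<le> v x"
  shows "v (zp_sub p (zp_div p x y) (zp_of_int p 1)) = prox x y"
proof -
  have "zp_div p x y (Suc k) \<noteq> zp_of_int p 1 (Suc k) \<longleftrightarrow> \<not> rel (Suc k) y x" for k
    unfolding zp_div_one_iff[OF assms] using rel_iff_eq[OF assms(2,1), of "Suc k"]
    by (auto simp: add.commute)
  then show ?thesis
    unfolding zp_val_sub[OF zp_div_Zp[OF assms] zp_of_int_Zp] prox_sym[of x]
    by (simp add: prox_def)
qed

text \<open>Both kernels depend on the valuations only through functions periodic modulo \<open>m\<close>;
  \<open>eta\<close> collects the terms of \<open>H\<close> off the diagonal shell, \<open>gg\<close> the Bernoulli part of \<open>h\<close>.\<close>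

definition eta :: "int \<Rightarrow> real" where
  "eta d = (let r = nat (d mod int m) in (P ^ (m - r) + P ^ r) / (P ^ m - 1))"

definition gg :: "int \<Rightarrow> real" where
  "gg d = (let r = real_of_int (d mod int m) in r * (r - real m) / (2 * real m) + real m / 12)"

lemma eta_minus: "eta (- d) = eta d"
proof (cases "d mod int m = 0")
  case False
  have "nat ((- d) mod int m) = m - nat (d mod int m)"
    using False m_pos pos_mod_sign[of "int m" d] pos_mod_bound[of "int m" d]
    by (simp only: zmod_zminus1_eq_if if_False) linarith
  moreover have "nat (d mod int m) \<le> m" using m_pos by (simp add: nat_le_iff less_imp_le)
  ultimately show ?thesis by (simp add: eta_def Let_def add.commute)
qed (simp add: eta_def zmod_zminus1_eq_if)

lemma gg_minus: "gg (- d) = gg d"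
proof (cases "d mod int m = 0")
  case False
  then have eq: "(- d) mod int m = int m - d mod int m"
    by (simp add: zmod_zminus1_eq_if)
  show ?thesis unfolding gg_def Let_def eq of_int_diff by (simp add: algebra_simps)
qed (simp add: gg_def zmod_zminus1_eq_if)

lemma eta_commute: "eta (a - b) = eta (b - a)"
  using eta_minus[of "a - b"] by simp

lemma gg_commute: "gg (a - b) = gg (b - a)"
  using gg_minus[of "a - b"] by simp

lemma Green_eq:
  assumes "x \<in> E" "y \<in> E"
  shows "Green p m x y = gg (int (v x) - int (v y)) + real (prox x y)"
proof -
  have *: "hgt p m (zp_div p x y) = gg (int (v x) - int (v y)) + real (prox x y)"
    if "x \<in> E" "y \<in> E" "v y \<le> v x" for x y
  proof -
    have "(int (v x) - int (v y)) mod int m = int (v x) - int (v y)"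
      using that E_val[of x] by (intro mod_pos_pos_trivial) auto
    then show ?thesis
      using that by (simp add: hgt_def zp_val_div_sub_one zp_val_div gg_def Let_def of_nat_diff)
  qed
  show ?thesis
    using *[OF assms] *[OF assms(2,1)] prox_sym[of x y] gg_commute[of "int (v x)"]
    by (auto simp: Green_def)
qed

lemma Green_sym: "x \<in> E \<Longrightarrow> y \<in> E \<Longrightarrow> Green p m x y = Green p m y x"
  using prox_sym[of x y] gg_commute[of "int (v x)"] by (simp add: Green_eq)

section \<open>Haar measure of balls\<close>

abbreviation "digit_measure \<equiv> PiM UNIV (\<lambda>_::nat. uniform_count_measure {0..<int p})"
abbreviation "seq_algebra \<equiv> PiM UNIV (\<lambda>_::nat. count_space (UNIV::int set))"

definition expand :: "(nat \<Rightarrow> int) \<Rightarrow> nat \<Rightarrow> int" where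
  "expand d n = (\<Sum>k<n. d k * int p ^ k)"

lemma haar_eq: "haar p = distr digit_measure seq_algebra expand"
  unfolding haar_def expand_def[abs_def] ..

lemma expand_bounds:
  assumes "\<And>k. d k \<in> {0..<int p}"
  shows "0 \<le> expand d n" "expand d n < int p ^ n"
proof (induction n)
  case (Suc n)
  {
    case 1
    show ?case using Suc(1) assms[of n] by (simp add: expand_def)
  next
    case 2
    have "d n * int p ^ n \<le> (int p - 1) * int p ^ n"
      using assms[of n] by (intro mult_right_mono) auto
    then show ?case using Suc(2) by (simp add: expand_def algebra_simps)
  }
qed (simp_all add: expand_def)

lemma expand_Zp: "(\<And>k. d k \<in> {0..<int p}) \<Longrightarrow> expand d \<in> Zp p"
  using expand_bounds[of d] by (auto simp: Zp_def) (auto simp: expand_def)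

text \<open>Digits in base p are unique; the induction splits off the top one. This turns a ball
  into a cylinder set of the digit space.\<close>

lemma expand_eq_iff:
  assumes "\<And>k. d k \<in> {0..<int p}" "0 \<le> c" "c < int p ^ n"
  shows "expand d n = c \<longleftrightarrow> (\<forall>k<n. d k = c div int p ^ k mod int p)"
  using assms(2,3)
proof (induction n arbitrary: c)
  case (Suc n)
  have pn: "int p ^ n > 0" using p_gt_1 by simp
  have "expand d (Suc n) = expand d n + d n * int p ^ n" by (simp add: expand_def)
  then have "expand d (Suc n) = c \<longleftrightarrow> expand d n = c mod int p ^ n \<and> d n = c div int p ^ n"
    using expand_bounds[of d n] assms(1) pn div_mult_mod_eq[of c "int p ^ n"] by auto
  also have "expand d n = c mod int p ^ n \<longleftrightarrow> (\<forall>k<n. d k = c mod int p ^ n div int p ^ k mod int p)"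
    using pn by (intro Suc.IH) simp_all
  also have "\<dots> \<longleftrightarrow> (\<forall>k<n. d k = c div int p ^ k mod int p)"
  proof -
    have "c mod int p ^ n div int p ^ k mod int p = c div int p ^ k mod int p" if "k < n" for k
    proof -
      have "int p ^ n = int p ^ k * int p ^ (n - k)" using that by (simp flip: power_add)
      then have "c mod int p ^ n = int p ^ k * (c div int p ^ k mod int p ^ (n - k)) + c mod int p ^ k"
        by (simp add: zmod_zmult2_eq)
      then have "c mod int p ^ n div int p ^ k = c div int p ^ k mod int p ^ (n - k)"
        using p_gt_1 by simp
      then show ?thesis using that by (simp add: mod_mod_cancel)
    qed
    then show ?thesis by auto
  qed
  \<comment> \<open>As c < p^(n + 1), the top quotient is already a digit.\<close>
  also have "c div int p ^ n = c div int p ^ n mod int p"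
  proof -
    have "c div int p ^ n < int p"
      proof (rule ccontr)
      assume "\<not> c div int p ^ n < int p"
      then have "int p * int p ^ n \<le> c div int p ^ n * int p ^ n"
        using pn by (intro mult_right_mono) simp_all
      also have "\<dots> \<le> c" using pn div_mult_mod_eq[of c "int p ^ n"] pos_mod_sign[of "int p ^ n" c] by linarith
      finally show False using Suc.prems by simp
    qed
    then show ?thesis using Suc.prems pn by (simp add: pos_imp_zdiv_nonneg_iff)
  qed
  finally show ?case by (auto simp: less_Suc_eq)
qed (simp add: expand_def)

lemma space_digit_measure: "d \<in> space digit_measure \<Longrightarrow> d k \<in> {0..<int p}"
  by (auto simp: space_PiM space_uniform_count_measure PiE_iff)

lemma prob_space_digit: "prob_space (uniform_count_measure {0..<int p})"
  using p_gt_1 by (intro prob_space_uniform_count_measure) auto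

lemma measurable_expand: "expand \<in> digit_measure \<rightarrow>\<^sub>M seq_algebra"
proof (rule measurable_PiM_single')
  fix n :: nat
  have digit: "(\<lambda>d. d k) \<in> digit_measure \<rightarrow>\<^sub>M count_space UNIV" for k
    using measurable_component_singleton[of k UNIV "\<lambda>_. uniform_count_measure {0..<int p}"]
    by (rule measurable_compose) (auto simp: measurable_def space_uniform_count_measure sets_uniform_count_measure)
  show "(\<lambda>d. expand d n) \<in> digit_measure \<rightarrow>\<^sub>M count_space UNIV"
  proof (induction n)
    case (Suc n)
    have "(\<lambda>d. expand d n + d n * int p ^ n) \<in> digit_measure \<rightarrow>\<^sub>M count_space UNIV"
      by (rule measurable_countable_binop[OF Suc digit])
    then show ?case by (simp add: expand_def)
  qed (simp add: expand_def)
qed (simp add: space_PiM)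

lemma space_haar [simp]: "space (haar p) = UNIV"
  by (simp add: haar_eq space_PiM)

lemma sets_haar [measurable_cong]: "sets (haar p) = sets seq_algebra"
  by (simp add: haar_eq)

lemma measurable_coord [measurable]: "(\<lambda>x. x n) \<in> haar p \<rightarrow>\<^sub>M count_space UNIV"
  by (simp add: measurable_cong_sets[OF sets_haar refl])

lemma Zp_sets [measurable]: "Zp p \<in> sets (haar p)"
proof -
  have [measurable]: "Measurable.pred (haar p) (\<lambda>x. x (Suc n) mod int p ^ n = x n)" for n
    by (rule measurable_countable_binop[OF measurable_coord measurable_coord,
          where h = "\<lambda>a b. a mod int p ^ n = b"])
  have "Measurable.pred (haar p) (\<lambda>x. \<forall>n. 0 \<le> x n \<and> x n < int p ^ n \<and> x (Suc n) mod int p ^ n = x n)"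
    by measurable
  then show ?thesis by (simp add: Zp_def pred_def)
qed

lemma Zp_ball_sets: "{x \<in> Zp p. x n = c} \<in> sets (haar p)"
proof -
  have "{x \<in> Zp p. x n = c} = {x \<in> space (haar p). x \<in> Zp p \<and> x n = c}" by simp
  also have "\<dots> \<in> sets (haar p)" by measurable
  finally show ?thesis .
qed

text \<open>A residue modulo p^n prescribes the first n digits, which are independent and
  uniform.\<close>

lemma emeasure_haar_ball:
  assumes "0 \<le> c" "c < int p ^ n"
  shows "emeasure (haar p) {x \<in> Zp p. x n = c} = ennreal (1 / P ^ n)"
proof -
  interpret digits: product_prob_space "\<lambda>_::nat. uniform_count_measure {0..<int p}" UNIV
    by (intro product_prob_spaceI prob_space_digit)
  have "emeasure (haar p) {x \<in> Zp p. x n = c} =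
      emeasure digit_measure (expand -` {x \<in> Zp p. x n = c} \<inter> space digit_measure)"
    using Zp_ball_sets[of n c] unfolding haar_eq by (intro emeasure_distr measurable_expand) simp
  also have "expand -` {x \<in> Zp p. x n = c} \<inter> space digit_measure
      = {d \<in> space digit_measure. \<forall>k\<in>{..<n}. d k \<in> {c div int p ^ k mod int p}}"
  proof -
    have "expand d \<in> Zp p \<and> (expand d n = c \<longleftrightarrow> (\<forall>k<n. d k = c div int p ^ k mod int p))"
      if "d \<in> space digit_measure" for d
      using space_digit_measure[OF that] expand_Zp expand_eq_iff assms by blast
    then show ?thesis by auto
  qed
  also have "emeasure digit_measure \<dots> =
      (\<Prod>k<n. emeasure (uniform_count_measure {0..<int p}) {c div int p ^ k mod int p})"
    using p_gt_1 by (intro digits.emeasure_PiM_Collect) (auto simp: sets_uniform_count_measure)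
  also have "\<dots> = (\<Prod>k<n. ennreal (1 / P))"
    using p_gt_1 by (intro prod.cong) (auto simp: emeasure_uniform_count_measure)
  also have "\<dots> = ennreal (1 / P ^ n)"
    by (subst prod_ennreal) (simp_all add: power_one_over)
  finally show ?thesis .
qed

section \<open>The multiplicative measure on balls and shells\<close>

lemma measurable_val_haar [measurable]: "v \<in> haar p \<rightarrow>\<^sub>M count_space UNIV"
  unfolding zp_val_def by measurable

lemma E_sets_haar [measurable]: "E \<in> sets (haar p)"
proof -
  have "E = {x \<in> space (haar p). x \<in> Zp p \<and> (\<exists>n. x n \<noteq> 0) \<and> v x < m}"
    by (auto simp: Edom_def)
  also have "\<dots> \<in> sets (haar p)" by measurable
  finally show ?thesis .
qed

lemma space_mstar [simp]: "space \<mu> = E"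
  by (simp add: mstar_def space_restrict_space)

lemma sets_mstar: "sets \<mu> = sets (restrict_space (haar p) E)"
  by (simp add: mstar_def)

lemma measurable_mstarI: "f \<in> haar p \<rightarrow>\<^sub>M N \<Longrightarrow> f \<in> \<mu> \<rightarrow>\<^sub>M N"
  by (simp add: measurable_cong_sets[OF sets_mstar refl] measurable_restrict_space1)

lemma measurable_coord_mstar [measurable]: "(\<lambda>x. x n) \<in> \<mu> \<rightarrow>\<^sub>M count_space UNIV"
  and measurable_val_mstar [measurable]: "v \<in> \<mu> \<rightarrow>\<^sub>M count_space UNIV"
  by (rule measurable_mstarI, measurable)+

text \<open>On one shell the density 1/|x| is constant, so the multiplicative measure is there a
  multiple of the additive one.\<close>

lemma emeasure_mstar_shell_subset:
  assumes "A \<in> sets (haar p)" "A \<subseteq> E" "\<And>x. x \<in> A \<Longrightarrow> v x = a"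
  shows "emeasure \<mu> A = ennreal (P ^ a) * emeasure (haar p) A"
proof -
  have A: "A \<in> sets (restrict_space (haar p) E)"
    using assms by (simp add: sets_restrict_space_iff)
  have "emeasure \<mu> A = (\<integral>\<^sup>+x. ennreal (P ^ v x) * indicator A x \<partial>restrict_space (haar p) E)"
    unfolding mstar_def
    by (intro emeasure_density A measurable_restrict_space1) measurable
  also have "\<dots> = (\<integral>\<^sup>+x. ennreal (P ^ a) * indicator A x \<partial>restrict_space (haar p) E)"
    using assms(3) by (intro nn_integral_cong) (auto simp: indicator_def)
  also have "\<dots> = ennreal (P ^ a) * emeasure (restrict_space (haar p) E) A"
    using A by (rule nn_integral_cmult_indicator)
  also have "emeasure (restrict_space (haar p) E) A = emeasure (haar p) A"
    using assms by (intro emeasure_restrict_space) auto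
  finally show ?thesis .
qed

text \<open>x(1 + p^k Z_p) = x + p^(v x + k) Z_p: a multiplicative ball is also an additive one, and
  k \<ge> 1 keeps it inside the shell of x and so inside E.\<close>

lemma rel_ball_eq:
  assumes "x \<in> E" "k \<ge> 1"
  shows "{z \<in> E. rel k x z} = {z \<in> Zp p. z (v x + k) = x (v x + k)}"
proof -
  have "z \<in> E" if z: "z \<in> Zp p" "z (v x + k) = x (v x + k)" for z
  proof -
    have *: "z n = x n" if "n \<le> v x + k" for n
      using Zp_eq_mono[of z x "v x + k" n] z that E_Zp assms(1) by simp
    have "z (Suc (v x)) = x (Suc (v x))" "z (v x) = x (v x)"
      using assms(2) by (auto intro!: *)
    then have nz: "z (Suc (v x)) \<noteq> 0" "z (v x) = 0"
      using E_zero_iff[OF assms(1)] by auto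
    then have "\<exists>n. z n \<noteq> 0" by blast
    then have "v z = v x" using nz Zp_zero_iff[OF z(1)] by (metis le_antisym not_less_eq_eq)
    then show ?thesis using z E_val[OF assms(1)] nz by (auto simp: Edom_def)
  qed
  then show ?thesis using rel_iff_eq[OF assms(1) _ assms(2)] E_Zp by auto
qed

lemma emeasure_ball:
  assumes "x \<in> E" "k \<ge> 1"
  shows "emeasure \<mu> {z \<in> E. rel k x z} = ennreal (1 / P ^ k)"
proof -
  have "emeasure \<mu> {z \<in> E. rel k x z} = ennreal (P ^ v x) * emeasure (haar p) {z \<in> E. rel k x z}"
  proof (rule emeasure_mstar_shell_subset)
    show "{z \<in> E. rel k x z} \<in> sets (haar p)"
      unfolding rel_ball_eq[OF assms] by (rule Zp_ball_sets)
  qed (auto simp: rel_def)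
  also have "emeasure (haar p) {z \<in> E. rel k x z} = ennreal (1 / P ^ (v x + k))"
    unfolding rel_ball_eq[OF assms] using assms(1) E_Zp
    by (intro emeasure_haar_ball Zp_bounds) auto
  also have "ennreal (P ^ v x) * ennreal (1 / P ^ (v x + k)) = ennreal (1 / P ^ k)"
    using p_gt_1 by (subst ennreal_mult[symmetric]) (auto simp: power_add)
  finally show ?thesis .
qed

lemma shell_eq: "a < m \<Longrightarrow> {z \<in> E. v z = a} = {z \<in> Zp p. z a = 0} - {z \<in> Zp p. z (Suc a) = 0}"
proof safe
  fix z assume z: "a < m" "z \<in> Zp p" "z a = 0" "z (Suc a) \<noteq> 0"
  then have "\<exists>n. z n \<noteq> 0" by blast
  then have "v z = a" using z Zp_zero_iff[OF z(2)] by (metis le_antisym not_less_eq_eq)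
  then show "z \<in> E" "v z = a" using z by (auto simp: Edom_def)
qed (auto simp: E_Zp E_zero_iff)

text \<open>A shell is a class of \<open>rel 0\<close>, but its volume is 1 - 1/P and not 1, because
  it is p^a times the units. Hence the ball volumes 1/P^k are stated for k \<ge> 1 only.\<close>

lemma emeasure_shell:
  assumes "a < m"
  shows "emeasure \<mu> {z \<in> E. v z = a} = ennreal (1 - 1 / P)"
proof -
  have "emeasure \<mu> {z \<in> E. v z = a} = ennreal (P ^ a) * emeasure (haar p) {z \<in> E. v z = a}"
  proof (rule emeasure_mstar_shell_subset)
    show "{z \<in> E. v z = a} \<in> sets (haar p)"
      unfolding shell_eq[OF assms] by (intro sets.Diff Zp_ball_sets)
  qed auto
  also have "emeasure (haar p) {z \<in> E. v z = a} = ennreal (1 / P ^ a) - ennreal (1 / P ^ Suc a)"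
  proof -
    have "{z \<in> Zp p. z (Suc a) = 0} \<subseteq> {z \<in> Zp p. z a = 0}"
    proof safe
      fix z assume "z \<in> Zp p" "z (Suc a) = 0"
      then show "z a = 0" using Zp_mod[of z a "Suc a"] by simp
    qed
    moreover have "emeasure (haar p) {z \<in> Zp p. z n = 0} = ennreal (1 / P ^ n)" for n
      using p_gt_1 by (intro emeasure_haar_ball) auto
    ultimately show ?thesis
      unfolding shell_eq[OF assms] by (subst emeasure_Diff) (auto simp: Zp_ball_sets)
  qed
  also have "\<dots> = ennreal (1 / P ^ a - 1 / P ^ Suc a)"
    using p_gt_1 by (intro ennreal_minus) simp
  also have "ennreal (P ^ a) * \<dots> = ennreal (P ^ a * (1 / P ^ a - 1 / P ^ Suc a))"
    using p_gt_1 by (intro ennreal_mult[symmetric]) (auto simp: field_simps)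
  also have "P ^ a * (1 / P ^ a - 1 / P ^ Suc a) = 1 - 1 / P"
    using p_gt_1 by (simp add: field_simps)
  finally show ?thesis .
qed

section \<open>Functions of finite level\<close>

lemma ball_sets [measurable]: "x \<in> E \<Longrightarrow> k \<ge> 1 \<Longrightarrow> {z \<in> E. rel k x z} \<in> sets \<mu>"
  using rel_ball_eq[of x k] Zp_ball_sets[of "v x + k" "x (v x + k)"]
  by (simp add: sets_mstar sets_restrict_space_iff) auto

lemma shell_sets: "{z \<in> E. v z = a} \<in> sets \<mu>"
proof -
  have "{z \<in> space \<mu>. v z = a} \<in> sets \<mu>" by measurable
  then show ?thesis by simp
qed

sublocale mu: finite_measure \<mu>
proof
  have "space \<mu> = (\<Union>a<m. {z \<in> E. v z = a})" using E_val by auto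
  then have "emeasure \<mu> (space \<mu>) \<le> (\<Sum>a<m. emeasure \<mu> {z \<in> E. v z = a})"
    using shell_sets by (simp only:) (rule emeasure_subadditive_finite, auto)
  also have "\<dots> < \<infinity>" by (simp add: emeasure_shell ennreal_mult_less_top of_nat_less_top)
  finally show "emeasure \<mu> (space \<mu>) \<noteq> \<infinity>" by simp
qed

lemma measure_ball: "x \<in> E \<Longrightarrow> k \<ge> 1 \<Longrightarrow> measure \<mu> {z \<in> E. rel k x z} = 1 / P ^ k"
  by (simp add: measure_def emeasure_ball)

lemma measure_shell: "a < m \<Longrightarrow> measure \<mu> {z \<in> E. v z = a} = 1 - 1 / P"
  using P_gt_1 by (simp add: measure_def emeasure_shell)

definition ind :: "nat \<Rightarrow> (nat \<Rightarrow> int) \<Rightarrow> (nat \<Rightarrow> int) \<Rightarrow> real" where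
  "ind k x z = of_bool (rel k x z)"

lemma ind_sym: "ind k x z = ind k z x"
  unfolding ind_def by (subst rel_sym) simp

lemma has_integral_ind:
  assumes "x \<in> E" "k \<ge> 1"
  shows "has_bochner_integral \<mu> (ind k x) (1 / P ^ k)"
proof -
  have "has_bochner_integral \<mu> (indicator {z \<in> E. rel k x z} :: _ \<Rightarrow> real) (measure \<mu> {z \<in> E. rel k x z})"
    using ball_sets[OF assms] mu.emeasure_finite
    by (intro has_bochner_integral_real_indicator) (auto simp: less_top[symmetric])
  then show ?thesis
    unfolding measure_ball[OF assms]
    by (rule has_bochner_integral_cong[THEN iffD1, rotated -1]) (auto simp: ind_def indicator_def)
qed

definition lev :: "nat \<Rightarrow> ((nat \<Rightarrow> int) \<Rightarrow> real) \<Rightarrow> bool" where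
  "lev N f \<longleftrightarrow> (\<forall>x\<in>E. \<forall>z\<in>E. rel N x z \<longrightarrow> f x = f z)"

lemma levD: "lev N f \<Longrightarrow> rel N x z \<Longrightarrow> x \<in> E \<Longrightarrow> z \<in> E \<Longrightarrow> f x = f z"
  unfolding lev_def by blast

lemma levI: "(\<And>x z. x \<in> E \<Longrightarrow> z \<in> E \<Longrightarrow> rel N x z \<Longrightarrow> f x = f z) \<Longrightarrow> lev N f"
  unfolding lev_def by blast

lemma lev_mono: "lev N f \<Longrightarrow> N \<le> M \<Longrightarrow> lev M f"
  unfolding lev_def by (meson rel_mono)

text \<open>The pair of valuation and residue characterises a class and takes finitely many values
  on E, as \<open>v\<close> stays below m. The representatives turn integrals into finite
  sums.\<close>

lemma finite_classes:
  "\<exists>W. finite W \<and> W \<subseteq> E \<and> (\<forall>x\<in>E. \<exists>!w. w \<in> W \<and> rel N w x)"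
proof -
  define c where "c x = (v x, x (v x + N))" for x
  have rel_c: "rel N x z \<longleftrightarrow> c x = c z" for x z
    by (auto simp: rel_def c_def)
  have "c ` E \<subseteq> {..<m} \<times> {0..<int p ^ (m + N)}"
  proof (intro image_subsetI)
    fix x assume x: "x \<in> E"
    have "x (v x + N) < int p ^ (v x + N)" using Zp_bounds[OF E_Zp[OF x]] by simp
    also have "\<dots> \<le> int p ^ (m + N)" using E_val[OF x] p_gt_1 by (intro power_increasing) auto
    finally show "c x \<in> {..<m} \<times> {0..<int p ^ (m + N)}"
      using E_val[OF x] Zp_bounds[OF E_Zp[OF x]] by (simp add: c_def)
  qed
  then have fin: "finite (c ` E)" by (rule finite_subset) simp
  define s where "s k = (SOME x. x \<in> E \<and> c x = k)" for k
  have s: "s (c x) \<in> E \<and> c (s (c x)) = c x" if "x \<in> E" for x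
    unfolding s_def by (rule someI[of _ x]) (use that in simp)
  show ?thesis
  proof (intro exI[of _ "s ` c ` E"] conjI ballI)
    fix x assume "x \<in> E"
    show "\<exists>!w. w \<in> s ` c ` E \<and> rel N w x"
    proof (rule ex1I[of _ "s (c x)"])
      show "s (c x) \<in> s ` c ` E \<and> rel N (s (c x)) x"
        using s[OF \<open>x \<in> E\<close>] \<open>x \<in> E\<close> rel_c by simp
      fix w assume w: "w \<in> s ` c ` E \<and> rel N w x"
      then obtain y where y: "y \<in> E" "w = s (c y)" by auto
      then have "c y = c x" using w s[of y] rel_c[of w x] by simp
      then show "w = s (c x)" using y by simp
    qed
  qed (use fin s in auto)
qed

text \<open>One W serves all f of level N; the exchange of integrals in
  \<open>lev_integral_swap\<close> rests on this uniformity.\<close>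

lemma lev_finite_sum:
  assumes "N \<ge> 1"
  shows "\<exists>W. finite W \<and> W \<subseteq> E \<and>
    (\<forall>f. lev N f \<longrightarrow> has_bochner_integral \<mu> f ((\<Sum>w\<in>W. f w) / P ^ N))"
proof -
  obtain W where W: "finite W" "W \<subseteq> E" "\<forall>x\<in>E. \<exists>!w. w \<in> W \<and> rel N w x"
    using finite_classes[of N] by blast
  show ?thesis
  proof (intro exI[of _ W] conjI allI impI W(1,2))
    fix f assume f: "lev N f"
    have eq: "(\<Sum>w\<in>W. f w * ind N w x) = f x" if x: "x \<in> E" for x
    proof -
      obtain u where u: "u \<in> W" "rel N u x" "\<And>w. w \<in> W \<Longrightarrow> rel N w x \<Longrightarrow> w = u"
        using bspec[OF W(3) x] by blast
      then have "\<And>w. w \<in> W \<Longrightarrow> rel N w x \<longleftrightarrow> w = u" by blast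
      then have "(\<Sum>w\<in>W. f w * ind N w x) = (\<Sum>w\<in>W. if w = u then f w else 0)"
        by (intro sum.cong refl) (simp add: ind_def)
      also have "\<dots> = f u" using u(1) W(1) by simp
      also have "f u = f x" using levD[OF f u(2)] u(1) W(2) x by blast
      finally show ?thesis .
    qed
    have "has_bochner_integral \<mu> (\<lambda>x. \<Sum>w\<in>W. f w * ind N w x) (\<Sum>w\<in>W. f w * (1 / P ^ N))"
      using W assms
      by (intro has_bochner_integral_sum has_bochner_integral_mult_right has_integral_ind) auto
    then have "has_bochner_integral \<mu> f (\<Sum>w\<in>W. f w * (1 / P ^ N))"
      by (rule has_bochner_integral_cong[THEN iffD1, rotated -1]) (auto simp: eq)
    then show "has_bochner_integral \<mu> f ((\<Sum>w\<in>W. f w) / P ^ N)"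
      by (simp add: sum_divide_distrib)
  qed
qed

lemma lev_integrable:
  assumes "lev N f" shows "integrable \<mu> f"
proof -
  \<comment> \<open>\<open>lev_finite_sum\<close> starts at level 1, while level 0, the functions of
    the valuation, is allowed here.\<close>
  have "lev (Suc N) f" using assms by (rule lev_mono) simp
  then obtain I where "has_bochner_integral \<mu> f I"
    using lev_finite_sum[of "Suc N"] by auto
  then show ?thesis by (rule has_bochner_integral_iff[THEN iffD1, THEN conjunct1])
qed

text \<open>Both integrals are sums over the same finite W, so Fubini reduces to
  \<open>sum.swap\<close>.\<close>

lemma lev_integral_swap:
  assumes "\<And>z. z \<in> E \<Longrightarrow> lev N (\<lambda>x. F x z)" "\<And>x. x \<in> E \<Longrightarrow> lev N (F x)"
  shows "(\<integral>x. \<integral>z. F x z \<partial>\<mu> \<partial>\<mu>) = (\<integral>z. \<integral>x. F x z \<partial>\<mu> \<partial>\<mu>)"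
proof -
  obtain W where W: "finite W" "W \<subseteq> E"
    "\<And>f. lev (Suc N) f \<Longrightarrow> has_bochner_integral \<mu> f ((\<Sum>w\<in>W. f w) / P ^ Suc N)"
    using lev_finite_sum[of "Suc N"] by auto
  have int: "integral\<^sup>L \<mu> f = (\<Sum>w\<in>W. f w) / P ^ Suc N" if "lev N f" for f
    using W(3)[OF lev_mono[OF that]] by (simp add: has_bochner_integral_iff)
  have eq: "x \<in> E \<Longrightarrow> (\<integral>z. F x z \<partial>\<mu>) = (\<Sum>w\<in>W. F x w) / P ^ Suc N"
    "z \<in> E \<Longrightarrow> (\<integral>x. F x z \<partial>\<mu>) = (\<Sum>w\<in>W. F w z) / P ^ Suc N" for x z
    using int assms by auto
  have "(\<integral>x. \<integral>z. F x z \<partial>\<mu> \<partial>\<mu>) = (\<integral>x. (\<Sum>w\<in>W. F x w) / P ^ Suc N \<partial>\<mu>)"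
    by (intro Bochner_Integration.integral_cong) (auto simp: eq)
  also have "\<dots> = (\<Sum>x\<in>W. (\<Sum>w\<in>W. F x w) / P ^ Suc N) / P ^ Suc N"
  proof (rule int, rule levI)
    fix x z assume "x \<in> E" "z \<in> E" "rel N x z"
    then show "(\<Sum>w\<in>W. F x w) / P ^ Suc N = (\<Sum>w\<in>W. F z w) / P ^ Suc N"
      using W(2) levD[OF assms(1)] by (intro arg_cong2[where f = "(/)"] sum.cong refl) blast
  qed
  also have "\<dots> = (\<Sum>z\<in>W. (\<Sum>w\<in>W. F w z) / P ^ Suc N) / P ^ Suc N"
    by (simp only: sum_divide_distrib[symmetric]) (subst sum.swap, rule refl)
  also have "\<dots> = (\<integral>z. (\<Sum>w\<in>W. F w z) / P ^ Suc N \<partial>\<mu>)"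
  proof (rule int[symmetric], rule levI)
    fix x z assume "x \<in> E" "z \<in> E" "rel N x z"
    then show "(\<Sum>w\<in>W. F w x) / P ^ Suc N = (\<Sum>w\<in>W. F w z) / P ^ Suc N"
      using W(2) levD[OF assms(2)] by (intro arg_cong2[where f = "(/)"] sum.cong refl) blast
  qed
  also have "\<dots> = (\<integral>z. \<integral>x. F x z \<partial>\<mu> \<partial>\<mu>)"
    by (intro Bochner_Integration.integral_cong) (auto simp: eq)
  finally show ?thesis .
qed

lemma lev_const [simp]: "lev N (\<lambda>_. c)"
  by (simp add: lev_def)

lemma lev_val [simp]: "lev N (\<lambda>x. F (v x))"
  by (simp add: lev_def rel_def)

lemma lev_ind: "k \<le> N \<Longrightarrow> y \<in> E \<Longrightarrow> lev N (ind k y)"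
proof -
  assume a: "k \<le> N" "y \<in> E"
  have "rel k y x \<longleftrightarrow> rel k y z" if "rel N x z" "x \<in> E" "z \<in> E" for x z
    using rel_mono[OF that(1) a(1) that(2,3)] rel_trans[of k y x z] rel_trans[of k y z x] rel_sym[of k x z]
    by blast
  then show ?thesis by (auto simp: lev_def ind_def)
qed

lemma lev_ind': "k \<le> N \<Longrightarrow> y \<in> E \<Longrightarrow> lev N (\<lambda>x. ind k x y)"
  unfolding ind_sym[of k _ y] by (rule lev_ind)


lemma lev_add: "lev N f \<Longrightarrow> lev N g \<Longrightarrow> lev N (\<lambda>x. f x + g x)"
  and lev_diff: "lev N f \<Longrightarrow> lev N g \<Longrightarrow> lev N (\<lambda>x. f x - g x)"
  and lev_mult: "lev N f \<Longrightarrow> lev N g \<Longrightarrow> lev N (\<lambda>x. f x * g x)"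
  by (auto intro!: levI arg_cong2[where f = "(+)"] arg_cong2[where f = "(-)"]
      arg_cong2[where f = "(*)"] elim: levD)

lemma lev_sum:
  assumes "\<And>i. i \<in> I \<Longrightarrow> lev N (h i)"
  shows "lev N (\<lambda>x. \<Sum>i\<in>I. h i x)"
  by (rule levI, rule sum.cong) (use levD[OF assms] in auto)

lemmas lev_intros = lev_add lev_diff lev_mult lev_sum lev_const lev_val lev_ind lev_ind'

lemma lev_integral:
  assumes "\<And>z. z \<in> E \<Longrightarrow> lev N (\<lambda>x. F x z)"
  shows "lev N (\<lambda>x. \<integral>z. F x z \<partial>\<mu>)"
proof (rule levI)
  fix x x' assume "x \<in> E" "x' \<in> E" "rel N x x'"
  then show "(\<integral>z. F x z \<partial>\<mu>) = (\<integral>z. F x' z \<partial>\<mu>)"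
    using levD[OF assms] by (intro Bochner_Integration.integral_cong refl) simp
qed

lemma integral_ind_mult:
  assumes "lev N f" "x \<in> E" "N \<ge> 1"
  shows "(\<integral>z. ind N x z * f z \<partial>\<mu>) = f x / P ^ N"
proof -
  have "(\<integral>z. ind N x z * f z \<partial>\<mu>) = (\<integral>z. ind N x z * f x \<partial>\<mu>)"
    using levD[OF assms(1), of x] assms(2)
    by (intro Bochner_Integration.integral_cong refl) (simp add: ind_def)
  also have "\<dots> = f x / P ^ N"
    using has_integral_ind[OF assms(2,3)] by (simp add: has_bochner_integral_iff)
  finally show ?thesis .
qed

lemma integral_val: "(\<integral>z. F (v z) \<partial>\<mu>) = (1 - 1 / P) * (\<Sum>j<m. F j)"
proof -
  have "has_bochner_integral \<mu> (\<lambda>z. \<Sum>j<m. F j * indicator {z \<in> E. v z = j} z)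
      (\<Sum>j<m. F j * measure \<mu> {z \<in> E. v z = j})"
    using shell_sets mu.emeasure_finite
    by (intro has_bochner_integral_sum has_bochner_integral_mult_right
        has_bochner_integral_real_indicator) (auto simp: less_top[symmetric])
  moreover have "(\<Sum>j<m. F j * measure \<mu> {z \<in> E. v z = j}) = (1 - 1 / P) * (\<Sum>j<m. F j)"
    unfolding sum_distrib_left by (intro sum.cong refl) (simp add: measure_shell mult.commute)
  ultimately have "(\<integral>z. (\<Sum>j<m. F j * indicator {z \<in> E. v z = j} z) \<partial>\<mu>) = (1 - 1 / P) * (\<Sum>j<m. F j)"
    by (simp only: has_bochner_integral_iff)
  moreover have "(\<integral>z. (\<Sum>j<m. F j * indicator {z \<in> E. v z = j} z) \<partial>\<mu>) = (\<integral>z. F (v z) \<partial>\<mu>)"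
  proof (rule Bochner_Integration.integral_cong)
    fix z assume z: "z \<in> space \<mu>"
    then have "(\<Sum>j<m. F j * indicator {z \<in> E. v z = j} z) = (\<Sum>j<m. if v z = j then F j else 0)"
      by (intro sum.cong) (auto simp: indicator_def)
    also have "\<dots> = F (v z)" using E_val[of z] z by (simp add: sum.delta')
    finally show "(\<Sum>j<m. F j * indicator {z \<in> E. v z = j} z) = F (v z)" .
  qed simp
  ultimately show ?thesis by simp
qed

lemma measure_E: "measure \<mu> E = volE p m"
  using integral_val[of "\<lambda>_. 1"] P_gt_1 by (simp add: volE_def field_simps)

section \<open>Composition of the kernels\<close>

lemma sum_periodic_shift:
  fixes F :: "int \<Rightarrow> real"
  assumes "\<And>n. F (n + int m) = F n"
  shows "(\<Sum>j<m. F (int j + 1)) = (\<Sum>j<m. F (int j))"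
proof -
  have "(\<Sum>j<m. F (int j + 1)) + F 0 = (\<Sum>j<m. F (int j)) + F (int m)"
    using sum.lessThan_Suc_shift[of "\<lambda>j. F (int j)" m] by (simp add: add.commute)
  then show ?thesis using assms[of 0] by simp
qed

lemma eta_periodic: "eta (d + int m) = eta d" and gg_periodic: "gg (d + int m) = gg d"
  by (simp_all add: eta_def gg_def)

lemma eta_mod: "eta (d mod int m) = eta d" and gg_mod: "gg (d mod int m) = gg d"
  by (simp_all add: eta_def gg_def)

lemma eta_nat: "r \<le> m \<Longrightarrow> eta (int r) = (P ^ (m - r) + P ^ r) / (P ^ m - 1)"
  using m_pos by (cases "r = m") (simp_all add: eta_def Let_def)

lemma gg_nat: "r \<le> m \<Longrightarrow> gg (int r) = real r * (real r - real m) / (2 * real m) + real m / 12"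
  using m_pos by (cases "r = m") (simp_all add: gg_def Let_def)

lemma mod_m_cases:
  obtains r where "r < m" "d mod int m = int r"
  using m_pos pos_mod_sign[of "int m" d] pos_mod_bound[of "int m" d]
  by (metis nonneg_int_cases of_nat_0_less_iff of_nat_less_iff less_le_trans zero_less_one)

lemma reduce_mod_m:
  fixes F :: "int \<Rightarrow> real"
  assumes "\<And>d. F (d mod int m) = F d"
  shows "F (d mod int m + 1) = F (d + 1)" "F (d mod int m - 1) = F (d - 1)"
proof -
  show "F (d mod int m + 1) = F (d + 1)"
    using assms[of "d mod int m + 1"] assms[of "d + 1"] by (simp add: mod_add_left_eq)
  show "F (d mod int m - 1) = F (d - 1)"
    using assms[of "d mod int m - 1"] assms[of "d - 1"] by (simp add: mod_diff_left_eq)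
qed

text \<open>\<open>eta d\<close> is the sum of P^(-|d + m n|) over all integers n. The sequence
  P^(-|d|) satisfies the homogeneous recurrence with factor P + 1/P except at 0, where its kink
  produces the defect P - 1/P.\<close>

lemma eta_recurrence:
  "eta (d + 1) + eta (d - 1) = (P + 1 / P) * eta d - (if d mod int m = 0 then P - 1 / P else 0)"
proof -
  obtain r where r: "r < m" "d mod int m = int r" by (rule mod_m_cases)
  have d: "eta (d + 1) = eta (int r + 1)" "eta (d - 1) = eta (int r - 1)" "eta d = eta (int r)"
    using reduce_mod_m[of eta d] eta_mod[of d] r(2) eta_mod by auto
  have plus: "eta (int r + 1) = (P ^ (m - Suc r) + P ^ Suc r) / (P ^ m - 1)"
    using eta_nat[of "Suc r"] r by (simp add: add.commute)
  have q: "P ^ m - 1 \<noteq> 0" using P_pm_gt_1 by simp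
  show ?thesis
  proof (cases r)
    case 0
    obtain k where k: "m = Suc k" using m_pos by (cases m) auto
    have minus: "eta (int r - 1) = eta (int r + 1)" using eta_minus[of 1] 0 by simp
    have "2 * (P ^ k + P) = (P + 1 / P) * (P ^ Suc k + 1) - (P - 1 / P) * (P ^ Suc k - 1)"
      using p_gt_1 by (simp add: field_simps)
    then have "2 * (P ^ k + P) / (P ^ m - 1) =
        (P + 1 / P) * ((P ^ m + 1) / (P ^ m - 1)) - (P - 1 / P)"
      using q unfolding k by (simp only: diff_divide_distrib times_divide_eq_right) simp
    then show ?thesis unfolding d r(2) minus plus using 0 k eta_nat[of 0] by simp
  next
    case (Suc s)
    obtain k where k: "m - r = Suc k" using r by (cases "m - r") auto
    have minus: "eta (int r - 1) = (P ^ (m - s) + P ^ s) / (P ^ m - 1)"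
      using eta_nat[of s] r Suc by simp
    have e: "m - Suc r = k" "m - s = Suc (Suc k)" using k Suc by linarith+
    have "P ^ k + P ^ Suc r + (P ^ Suc (Suc k) + P ^ s) = (P + 1 / P) * (P ^ Suc k + P ^ r)"
      using p_gt_1 Suc by (simp add: field_simps)
    then show ?thesis unfolding d r(2) minus plus e using Suc eta_nat[of r] r k
      by (simp add: add_divide_distrib[symmetric])
  qed
qed

text \<open>\<open>gg\<close> is (m/2) B_2(r/m) for the second Bernoulli polynomial B_2. Its second
  difference is 1/m, and the corner at multiples of m contributes -1: it is, up to sign convention,
  a Green's function of the discrete Laplacian on Z/m.\<close>

lemma gg_recurrence:
  "gg (d + 1) + gg (d - 1) = 2 * gg d + 1 / real m - (if d mod int m = 0 then 1 else 0)"
proof -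
  obtain r where r: "r < m" "d mod int m = int r" by (rule mod_m_cases)
  have d: "gg (d + 1) = gg (int r + 1)" "gg (d - 1) = gg (int r - 1)" "gg d = gg (int r)"
    using reduce_mod_m[of gg d] gg_mod[of d] r(2) gg_mod by auto
  have plus: "gg (int r + 1) = real (Suc r) * (real (Suc r) - real m) / (2 * real m) + real m / 12"
    using gg_nat[of "Suc r"] r by (simp add: add.commute)
  show ?thesis
  proof (cases r)
    case 0
    have minus: "gg (int r - 1) = gg (int r + 1)" using gg_minus[of 1] 0 by simp
    show ?thesis unfolding d r(2) minus plus using 0 m_pos gg_nat[of 0] by (simp add: field_simps)
  next
    case (Suc s)
    have minus: "gg (int r - 1) = real s * (real s - real m) / (2 * real m) + real m / 12"
      using gg_nat[of s] r Suc by simp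
    have gr: "gg (int r) = real r * (real r - real m) / (2 * real m) + real m / 12"
      using gg_nat[of r] r by simp
    show ?thesis unfolding d r(2) minus plus gr using Suc m_pos by (simp add: field_simps)
  qed
qed

lemma mod_diff_eq_0_iff: "j < m \<Longrightarrow> a < m \<Longrightarrow> (int j - int a) mod int m = 0 \<longleftrightarrow> j = a"
  by (simp add: mod_eq_dvd_iff[symmetric] mod_eq_0_iff_dvd)

lemma sum_delta_mod:
  fixes F :: "int \<Rightarrow> real"
  assumes "a < m"
  shows "(\<Sum>j<m. (if (int j - int a) mod int m = 0 then c else 0) * F (int j)) = c * F (int a)"
proof -
  have "(\<Sum>j<m. (if (int j - int a) mod int m = 0 then c else 0) * F (int j))
      = (\<Sum>j<m. if j = a then c * F (int j) else 0)"
    using assms by (intro sum.cong refl) (auto simp: mod_diff_eq_0_iff)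
  then show ?thesis using assms by simp
qed

text \<open>The sum of the two unit shifts is self-adjoint on functions periodic modulo m.\<close>

lemma summation_by_parts:
  fixes F G :: "int \<Rightarrow> real"
  assumes "\<And>n. F (n + int m) = F n" "\<And>n. G (n + int m) = G n"
  shows "(\<Sum>j<m. (F (int j + 1) + F (int j - 1)) * G (int j)) =
         (\<Sum>j<m. F (int j) * (G (int j + 1) + G (int j - 1)))"
proof -
  have *: "F (n - 1 + int m) = F (n - 1)" "G (n - 1 + int m) = G (n - 1)" for n
    using assms by blast+
  have "(\<Sum>j<m. F (int j + 1) * G (int j)) = (\<Sum>j<m. F (int j) * G (int j - 1))"
    using sum_periodic_shift[of "\<lambda>n. F n * G (n - 1)"] assms *
    by (simp add: algebra_simps)
  moreover have "(\<Sum>j<m. F (int j - 1) * G (int j)) = (\<Sum>j<m. F (int j) * G (int j + 1))"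
    using sum_periodic_shift[of "\<lambda>n. F (n - 1) * G n"] assms *
    by (simp add: algebra_simps)
  ultimately show ?thesis by (simp add: algebra_simps sum.distrib)
qed

text \<open>Summing the recurrence over a period gives a linear equation for the sum, with
  coefficient P + 1/P - 2 = (P - 1)^2 / P.\<close>

lemma sum_eta:
  assumes "a < m"
  shows "(\<Sum>j<m. eta (int j - int a)) = (P + 1) / (P - 1)"
proof -
  let ?S = "\<Sum>j<m. eta (int j - int a)"
  have "(\<Sum>j<m. (eta (int j - int a + 1) + eta (int j - int a - 1)) * 1) = (\<Sum>j<m. eta (int j - int a) * (1 + 1))"
    using summation_by_parts[of "\<lambda>n. eta (n - int a)" "\<lambda>_. 1"] eta_periodic[of "_ - int a"]
    by (simp add: algebra_simps)
  moreover have "(\<Sum>j<m. (eta (int j - int a + 1) + eta (int j - int a - 1)) * 1)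
      = (P + 1 / P) * ?S - (P - 1 / P)"
    using sum_delta_mod[OF assms, of "P - 1 / P" "\<lambda>_. 1"]
    by (simp add: eta_recurrence sum_subtractf sum_distrib_left)
  moreover have "(\<Sum>j<m. eta (int j - int a) * (1 + 1)) = 2 * ?S"
    by (simp add: sum_distrib_left mult.commute)
  ultimately have "(P + 1 / P - 2) * ?S = P - 1 / P"
    unfolding left_diff_distrib by linarith
  then have "(P - 1) * ((P - 1) * ?S) = (P - 1) * (P + 1)"
    using p_gt_1 by (simp add: field_simps)
  then have "(P - 1) * ?S = P + 1" using P_gt_1 by simp
  then show ?thesis using P_gt_1 by (simp add: field_simps)
qed

text \<open>Applying the recurrence of \<open>eta\<close> on one side of the summation by parts and
  that of \<open>gg\<close> on the other gives two expressions in the unknown convolution. Their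
  difference isolates it with the factor P + 1/P - 2, the prefactor on the left.\<close>

lemma eta_gg_convolution:
  assumes "a < m" "b < m"
  shows "(P - 1)\<^sup>2 / P * (\<Sum>j<m. eta (int a - int j) * gg (int j - int b))
    = (P - 1 / P) * gg (int a - int b) + (P + 1) / (real m * (P - 1)) - eta (int a - int b)"
proof -
  let ?S = "\<Sum>j<m. eta (int j - int a) * gg (int j - int b)"
  have "(\<Sum>j<m. (eta (int j - int a + 1) + eta (int j - int a - 1)) * gg (int j - int b))
      = (\<Sum>j<m. eta (int j - int a) * (gg (int j - int b + 1) + gg (int j - int b - 1)))"
    using summation_by_parts[of "\<lambda>n. eta (n - int a)" "\<lambda>n. gg (n - int b)"]
      eta_periodic[of "_ - int a"] gg_periodic[of "_ - int b"]
    by (simp add: algebra_simps)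
  moreover have "(\<Sum>j<m. (eta (int j - int a + 1) + eta (int j - int a - 1)) * gg (int j - int b))
      = (P + 1 / P) * ?S - (P - 1 / P) * gg (int a - int b)"
    using sum_delta_mod[OF assms(1), of "P - 1 / P" "\<lambda>n. gg (n - int b)"]
    by (simp only: eta_recurrence left_diff_distrib sum_subtractf sum_distrib_left mult.assoc)
  moreover have "(\<Sum>j<m. eta (int j - int a) * (gg (int j - int b + 1) + gg (int j - int b - 1)))
      = 2 * ?S + (P + 1) / (P - 1) * (1 / real m) - eta (int b - int a)"
  proof -
    have "(\<Sum>j<m. eta (int j - int a) * (gg (int j - int b + 1) + gg (int j - int b - 1)))
        = (\<Sum>j<m. 2 * (eta (int j - int a) * gg (int j - int b)) + eta (int j - int a) * (1 / real m)
            - (if (int j - int b) mod int m = 0 then 1 else 0) * eta (int j - int a))"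
      unfolding gg_recurrence by (intro sum.cong refl) (simp add: algebra_simps)
    also have "\<dots> = 2 * ?S + (\<Sum>j<m. eta (int j - int a)) * (1 / real m) - 1 * eta (int b - int a)"
      unfolding sum_subtractf sum.distrib sum_distrib_left[symmetric] sum_distrib_right[symmetric]
      by (subst sum_delta_mod[OF assms(2), of 1 "\<lambda>n. eta (n - int a)"]) simp
    finally show ?thesis by (simp add: sum_eta[OF assms(1)])
  qed
  ultimately have "(P + 1 / P - 2) * ?S = (P - 1 / P) * gg (int a - int b) + (P + 1) / (P - 1) * (1 / real m) - eta (int b - int a)"
    by (simp add: algebra_simps)
  moreover have "(P + 1 / P - 2) = (P - 1)\<^sup>2 / P"
    using p_gt_1 by (simp add: field_simps power2_eq_square)
  moreover have "(P + 1) / (P - 1) * (1 / real m) = (P + 1) / (real m * (P - 1))"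
    by simp
  moreover have "(\<Sum>j<m. eta (int a - int j) * gg (int j - int b)) = ?S"
    by (simp add: eta_commute[of "int a"])
  ultimately show ?thesis by (simp add: eta_commute[of "int b"])
qed

section \<open>Truncated kernels and their composition\<close>

lemma lev_divide: "lev N f \<Longrightarrow> lev N (\<lambda>x. f x / c)"
  by (rule levI, rule arg_cong2[where f = "(/)"]) (auto elim: levD)

text \<open>On one shell |x||z|/|x - z|^2 equals P^(2 prox). \<open>alpha k\<close> is the jump of
  this value from k - 1 to k, so that summing \<open>alpha\<close> over the levels shared by both
  points recovers it up to the constant 1.\<close>

definition alpha :: "nat \<Rightarrow> real" where
  "alpha k = (P ^ k)\<^sup>2 - (P ^ k)\<^sup>2 / P\<^sup>2"

text \<open>\<open>hN N\<close> agrees with \<open>H\<close> off the balls of level \<open>N\<close>, and \<open>gN N\<close> is the average of \<open>G\<close> over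
  such balls.\<close>

definition hN :: "nat \<Rightarrow> (nat \<Rightarrow> int) \<Rightarrow> (nat \<Rightarrow> int) \<Rightarrow> real" where
  "hN N x z = eta (int (v x) - int (v z)) + (\<Sum>k=1..<N. alpha k * ind k x z)"

definition gN :: "nat \<Rightarrow> (nat \<Rightarrow> int) \<Rightarrow> (nat \<Rightarrow> int) \<Rightarrow> real" where
  "gN N x y = gg (int (v x) - int (v y)) + (\<Sum>k=1..<N. ind k x y) + P / (P - 1) * ind N x y"

text \<open>The mass of \<open>hN N x\<close> (see \<open>integral_hN\<close>), hence the
  coefficient of the multiplication term in \<open>Lop\<close>.\<close>

definition rho :: "nat \<Rightarrow> real" where
  "rho N = (P + 1) * P ^ N / P\<^sup>2"

lemma hN_sym: "hN N x z = hN N z x"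
  unfolding hN_def by (subst ind_sym) (simp add: eta_commute)

lemma lev_hN: "x \<in> E \<Longrightarrow> lev N (hN N x)"
  unfolding hN_def[abs_def] by (intro lev_intros) auto

lemma lev_hN': "x \<in> E \<Longrightarrow> lev N (\<lambda>z. hN N z x)"
  unfolding hN_sym[of N _ x] by (rule lev_hN)

lemma lev_gN: "y \<in> E \<Longrightarrow> lev N (\<lambda>x. gN N x y)"
  unfolding gN_def by (intro lev_intros) auto

lemma hN_Suc: "N \<ge> 1 \<Longrightarrow> hN (Suc N) x z = hN N x z + alpha N * ind N x z"
  by (simp add: hN_def)

text \<open>The increment has integral zero over each ball of level N, since P/(P - 1) times the
  volume 1/P^(N + 1) equals 1/(P - 1) times 1/P^N. So \<open>gN N\<close> is the average of
  \<open>gN (Suc N)\<close>.\<close>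

lemma gN_Suc: "N \<ge> 1 \<Longrightarrow> gN (Suc N) x y =
    gN N x y + (P / (P - 1) * ind (Suc N) x y - 1 / (P - 1) * ind N x y)"
proof -
  have "P / (P - 1) = 1 + 1 / (P - 1)" using P_gt_1 by (simp add: field_simps)
  moreover assume "N \<ge> 1"
  ultimately show ?thesis by (simp add: gN_def distrib_right)
qed

lemma rho_Suc: "rho (Suc N) = rho N + alpha N / P ^ N"
  using p_gt_1 by (simp add: rho_def alpha_def field_simps power2_eq_square)

lemma integral_hN:
  assumes "x \<in> E" "N \<ge> 1"
  shows "(\<integral>z. hN N x z \<partial>\<mu>) = rho N"
  using assms(2)
proof (induction N rule: dec_induct)
  case base
  have "(\<integral>z. hN 1 x z \<partial>\<mu>) = (1 - 1 / P) * (\<Sum>j<m. eta (int (v x) - int j))"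
    unfolding hN_def using integral_val[of "\<lambda>j. eta (int (v x) - int j)"] by simp
  also have "(\<Sum>j<m. eta (int (v x) - int j)) = (P + 1) / (P - 1)"
    using sum_eta[OF E_val[OF assms(1)]] by (simp add: eta_commute[of "int (v x)"])
  also have "(1 - 1 / P) * ((P + 1) / (P - 1)) = rho 1"
    using P_gt_1 by (simp add: rho_def power2_eq_square field_simps)
  finally show ?case .
next
  case (step N)
  have "(\<integral>z. hN (Suc N) x z \<partial>\<mu>) = (\<integral>z. hN N x z + alpha N * ind N x z \<partial>\<mu>)"
    using step.hyps by (simp add: hN_Suc)
  also have "\<dots> = (\<integral>z. hN N x z \<partial>\<mu>) + alpha N * (\<integral>z. ind N x z \<partial>\<mu>)"
    using assms(1)
    by (subst Bochner_Integration.integral_add)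
       (auto intro!: lev_integrable[of N] lev_hN lev_intros)
  also have "(\<integral>z. ind N x z \<partial>\<mu>) = 1 / P ^ N"
    using has_integral_ind[OF assms(1), of N] step.hyps by (simp add: has_bochner_integral_iff)
  finally show ?case using step.IH by (simp add: rho_Suc)
qed

text \<open>\<open>gN\<close> would be an eigenfunction with eigenvalue \<open>rho N\<close> but for
  two terms: a constant, which stems from the 1/m in \<open>gg_recurrence\<close>, and a ball
  indicator, which becomes the delta.\<close>

lemma integral_hN_gN:
  assumes "x \<in> E" "y \<in> E" "N \<ge> 1"
  shows "(\<integral>z. hN N x z * gN N z y \<partial>\<mu>) =
    rho N * gN N x y + (P + 1) / (real m * (P - 1)\<^sup>2) - P ^ N * ind N x y * (P + 1) / (P * (P - 1))"
  using assms(3)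
proof (induction N rule: dec_induct)
  case base
  let ?e = "\<lambda>z. eta (int (v x) - int (v z))" and ?g = "\<lambda>z. gg (int (v z) - int (v y))"
  have "(\<integral>z. hN 1 x z * gN 1 z y \<partial>\<mu>) = (\<integral>z. ?e z * ?g z + P / (P - 1) * (ind 1 y z * ?e z) \<partial>\<mu>)"
    unfolding hN_def gN_def ind_sym[of 1 _ y] by (simp add: algebra_simps)
  also have "\<dots> = (\<integral>z. ?e z * ?g z \<partial>\<mu>) + P / (P - 1) * (\<integral>z. ind 1 y z * ?e z \<partial>\<mu>)"
    using assms by (subst Bochner_Integration.integral_add)
       (auto intro!: lev_integrable[of 1] lev_intros lev_divide)
  also have "(\<integral>z. ind 1 y z * ?e z \<partial>\<mu>) = ?e y / P"
    using integral_ind_mult[OF lev_val[of 1 "\<lambda>n. eta (int (v x) - int n)"] assms(2)] by simp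
  also have "(\<integral>z. ?e z * ?g z \<partial>\<mu>) =
      (1 - 1 / P) * (\<Sum>j<m. eta (int (v x) - int j) * gg (int j - int (v y)))"
    by (rule integral_val)
  \<comment> \<open>The prefactor is split so that the left side of
    \<open>eta_gg_convolution\<close> appears. The term -eta obtained from it cancels against the
    ball term of level 1, as both carry the weight 1/(P - 1).\<close>
  also have "\<dots> = P / (P - 1)\<^sup>2 * (1 - 1 / P) *
      ((P - 1)\<^sup>2 / P * (\<Sum>j<m. eta (int (v x) - int j) * gg (int j - int (v y))))"
    using P_gt_1 by simp
  also have "\<dots> = P / (P - 1)\<^sup>2 * (1 - 1 / P) * ((P - 1 / P) * gg (int (v x) - int (v y))
      + (P + 1) / (real m * (P - 1)) - ?e y)"
    unfolding eta_gg_convolution[OF E_val[OF assms(1)] E_val[OF assms(2)]] ..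
  finally show ?case using P_gt_1 m_pos unfolding rho_def gN_def
    by (simp add: power2_eq_square divide_simps) (simp add: algebra_simps)
next
  case (step N)
  define \<Delta> where "\<Delta> z = P / (P - 1) * ind (Suc N) z y - 1 / (P - 1) * ind N z y" for z
  have lev\<Delta>: "lev (Suc N) \<Delta>"
    unfolding \<Delta>_def[abs_def] using assms by (intro lev_intros) auto
  \<comment> \<open>A function of level N is constant on the ball where \<Delta> lives, and \<Delta>
    has mean zero there. Hence of the three new products in the induction step only
    \<open>ind N\<close> times \<open>gN N\<close> contributes.\<close>
  have \<Delta>0: "(\<integral>z. f z * \<Delta> z \<partial>\<mu>) = 0" if f: "lev N f" for f
  proof -
    have f': "lev (Suc N) f" using f by (rule lev_mono) simp
    have "(\<integral>z. f z * \<Delta> z \<partial>\<mu>) =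
        (\<integral>z. P / (P - 1) * (ind (Suc N) y z * f z) - 1 / (P - 1) * (ind N y z * f z) \<partial>\<mu>)"
      by (simp add: \<Delta>_def ind_sym[of _ y] algebra_simps)
    also have "\<dots> = P / (P - 1) * (\<integral>z. ind (Suc N) y z * f z \<partial>\<mu>) - 1 / (P - 1) * (\<integral>z. ind N y z * f z \<partial>\<mu>)"
      using assms f' by (subst Bochner_Integration.integral_diff)
        (auto intro!: lev_integrable[of "Suc N"] lev_intros lev_divide)
    also have "\<dots> = 0"
      using integral_ind_mult[OF f assms(2) step.hyps(1)] integral_ind_mult[OF f' assms(2)] P_gt_1
      by simp
    finally show ?thesis .
  qed
  have levg: "lev N (\<lambda>z. gN N z y)" by (rule lev_gN[OF assms(2)])
  note levh = lev_hN[OF assms(1), of N] and levi = lev_ind[OF order_refl assms(1), of N]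
  have int: "integrable \<mu> f" if "lev (Suc N) f" for f
    using that by (rule lev_integrable)
  have up: "lev (Suc N) f" if "lev N f" for f
    using that by (rule lev_mono) simp
  have "(\<integral>z. hN (Suc N) x z * gN (Suc N) z y \<partial>\<mu>) =
      (\<integral>z. hN N x z * gN N z y + hN N x z * \<Delta> z +
        (alpha N * (ind N x z * gN N z y) + alpha N * (ind N x z * \<Delta> z)) \<partial>\<mu>)"
    unfolding hN_Suc[OF step.hyps(1)] gN_Suc[OF step.hyps(1)] \<Delta>_def[symmetric]
    by (simp add: algebra_simps)
  also have "\<dots> = (\<integral>z. hN N x z * gN N z y \<partial>\<mu>) + (\<integral>z. hN N x z * \<Delta> z \<partial>\<mu>) +
      (alpha N * (\<integral>z. ind N x z * gN N z y \<partial>\<mu>) + alpha N * (\<integral>z. ind N x z * \<Delta> z \<partial>\<mu>))"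
    using up[OF levg] up[OF levh] up[OF levi] lev\<Delta>
    by (simp add: Bochner_Integration.integral_add int lev_mult lev_add)
  also have "\<dots> = (\<integral>z. hN N x z * gN N z y \<partial>\<mu>) + alpha N / P ^ N * gN N x y"
    using \<Delta>0[OF levh] \<Delta>0[OF levi] integral_ind_mult[OF levg assms(1) step.hyps(1)] by simp
  also have "\<dots> = rho (Suc N) * gN N x y
      + (P + 1) / (real m * (P - 1)\<^sup>2) - P ^ N * ind N x y * (P + 1) / (P * (P - 1))"
    unfolding step.IH rho_Suc by (simp add: algebra_simps)
  also have "\<dots> = rho (Suc N) * gN (Suc N) x y
      + (P + 1) / (real m * (P - 1)\<^sup>2) - P ^ Suc N * ind (Suc N) x y * (P + 1) / (P * (P - 1))"
  proof -
    have "rho (Suc N) * (P / (P - 1) * ind (Suc N) x y - 1 / (P - 1) * ind N x y) =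
      P ^ Suc N * ind (Suc N) x y * (P + 1) / (P * (P - 1)) - P ^ N * ind N x y * (P + 1) / (P * (P - 1))"
      using P_gt_1 by (simp add: rho_def power2_eq_square divide_simps) (simp add: algebra_simps)
    then show ?thesis unfolding gN_Suc[OF step.hyps(1)] by (simp add: algebra_simps)
  qed
  finally show ?case .
qed

section \<open>The operator on functions of finite level\<close>

lemma zp_abs_nonzero: "\<exists>n. x n \<noteq> 0 \<Longrightarrow> zp_abs p x = 1 / P ^ v x"
  using p_gt_1 by (auto simp: zp_abs_def powr_minus powr_realpow divide_inverse)

lemma zp_abs_E: "x \<in> E \<Longrightarrow> zp_abs p x = 1 / P ^ v x"
  by (rule zp_abs_nonzero) (auto simp: Edom_def)

lemma Hker_sym: "x \<in> E \<Longrightarrow> z \<in> E \<Longrightarrow> Hker p m z x = Hker p m x z"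
proof (cases "x = z")
  case False
  assume xz: "x \<in> E" "z \<in> E"
  then have "zp_abs p (zp_sub p x z) = zp_abs p (zp_sub p z x)"
    using False zp_sub_val_sym[of x z] by (simp add: zp_abs_nonzero zp_sub_nonzero E_Zp)
  then show ?thesis by (simp add: Hker_def algebra_simps)
qed simp

lemma sum_alpha: "(\<Sum>k=1..r. alpha k) = (P ^ r)\<^sup>2 - 1"
proof (induction r)
  case (Suc r)
  have "alpha (Suc r) = (P ^ Suc r)\<^sup>2 - (P ^ r)\<^sup>2"
    using p_gt_1 by (simp add: alpha_def power_mult_distrib)
  then show ?case using Suc by simp
qed simp

text \<open>Off the shell, 1/P^d and the two correction terms of \<open>Hker\<close> combine to
  \<open>eta\<close>. On the shell the correction 2/(P^m - 1) is eta 0 - 1, which absorbs the -1 of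
  the telescoping sum of \<open>alpha\<close>.\<close>

lemma Hker_eq_hN:
  assumes "x \<in> E" "z \<in> E" "\<not> rel N x z" "N \<ge> 1"
  shows "Hker p m z x = hN N x z"
proof -
  have *: "Hker p m z x = eta (int (v z) - int (v x))" if "x \<in> E" "z \<in> E" "v x < v z" for x z
  proof -
    define d where "d = v z - v x"
    have d: "v z = v x + d" "d \<le> m" using that E_val[of z] by (auto simp: d_def)
    have ne: "x \<noteq> z" using that by auto
    have "Hker p m z x = 1 / P ^ d + 1 / (P ^ m - 1) * (P ^ d + 1 / P ^ d)"
      using that p_gt_1 zp_abs_nonzero[OF zp_sub_nonzero[OF E_Zp E_Zp ne]]
      by (simp add: Hker_def zp_abs_E zp_val_sub_diff d(1) power_add power2_eq_square field_simps)
    also have "\<dots> = (P ^ m / P ^ d + P ^ d) / (P ^ m - 1)"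
      using P_pm_gt_1 by (simp add: divide_simps)
    also have "P ^ m / P ^ d = P ^ (m - d)"
      using d(2) p_gt_1 by (simp add: power_diff)
    finally show ?thesis using eta_nat[OF d(2)] d(1) by simp
  qed
  show ?thesis
  proof (cases "v x = v z")
    case False
    then have "hN N x z = eta (int (v x) - int (v z))"
      by (simp add: hN_def ind_def rel_def)
    then show ?thesis
      using *[of x z] *[of z x] False assms Hker_sym[of x z] eta_commute[of "int (v x)"]
      by (cases "v x < v z") auto
  next
    case True
    have ne: "x \<noteq> z" using assms(3) by auto
    define r where "r = prox x z"
    have r: "rel k x z \<longleftrightarrow> k \<le> r" if "k \<ge> 1" for k
      unfolding r_def by (rule rel_iff_prox[OF assms(1,2) ne that])
    have "(\<Sum>k=1..<N. alpha k * ind k x z) = (\<Sum>k=1..<N. if k \<le> r then alpha k else 0)"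
      by (intro sum.cong refl) (simp add: ind_def r)
    also have "\<dots> = (\<Sum>k\<in>{k\<in>{1..<N}. k \<le> r}. alpha k)"
      by (rule sum.inter_filter[symmetric]) simp
    \<comment> \<open>As x and z do not share a ball of level N, r < N and the truncation loses
      nothing.\<close>
    also have "{k\<in>{1..<N}. k \<le> r} = {1..r}"
      using r[OF assms(4)] assms(3) by auto
    finally have h: "hN N x z = eta 0 + ((P ^ r)\<^sup>2 - 1)"
      using True unfolding hN_def sum_alpha[symmetric] by simp
    have A: "zp_abs p (zp_sub p x z) = 1 / P ^ (v x + r)"
      using zp_val_sub_same[OF assms(1,2) True ne] zp_sub_nonzero[OF E_Zp[OF assms(1)] E_Zp[OF assms(2)] ne]
      by (simp add: zp_abs_nonzero r_def)
    have "Hker p m z x = 1 / P ^ v z * (1 / P ^ v z) / (1 / P ^ (v z + r))\<^sup>2 + 1 / (P ^ m - 1) * (1 + 1)"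
      unfolding Hker_def A zp_abs_E[OF assms(1)] zp_abs_E[OF assms(2)] True using p_gt_1 by simp
    also have "\<dots> = (P ^ r)\<^sup>2 + 2 / (P ^ m - 1)"
      using p_gt_1 by (simp add: power_add power2_eq_square)
    also have "\<dots> = eta 0 + ((P ^ r)\<^sup>2 - 1)"
      using eta_nat[of 0] P_pm_gt_1 by (simp add: field_simps)
    finally show ?thesis using h by simp
  qed
qed

definition Lop :: "nat \<Rightarrow> ((nat \<Rightarrow> int) \<Rightarrow> real) \<Rightarrow> (nat \<Rightarrow> int) \<Rightarrow> real" where
  "Lop N f x = (\<integral>z. hN N x z * f z \<partial>\<mu>) - rho N * f x"

lemma Dop_eq_Lop:
  assumes "lev N \<phi>" "x \<in> E" "N \<ge> 1"
  shows "Dop p m \<phi> x = - cp p * Lop N \<phi> x"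
proof -
  have "(\<integral>z. Hker p m z x * (\<phi> z - \<phi> x) \<partial>\<mu>) = (\<integral>z. hN N x z * \<phi> z - \<phi> x * hN N x z \<partial>\<mu>)"
  proof (rule Bochner_Integration.integral_cong[OF refl])
    fix z assume "z \<in> space \<mu>"
    then have z: "z \<in> E" by simp
    \<comment> \<open>Inside the ball of level N the kernels may differ, and at z = x
      \<open>Hker\<close> divides by zero; but there \<open>\<phi>\<close> is constant and the
      factor vanishes.\<close>
    have "Hker p m z x = hN N x z \<or> \<phi> x = \<phi> z"
      using Hker_eq_hN[OF assms(2) z _ assms(3)] levD[OF assms(1) _ assms(2) z] by blast
    then show "Hker p m z x * (\<phi> z - \<phi> x) = hN N x z * \<phi> z - \<phi> x * hN N x z"
      by (auto simp: algebra_simps)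
  qed
  also have "\<dots> = (\<integral>z. hN N x z * \<phi> z \<partial>\<mu>) - \<phi> x * (\<integral>z. hN N x z \<partial>\<mu>)"
    using lev_integrable[OF lev_hN[OF assms(2), of N]]
      lev_integrable[OF lev_mult[OF lev_hN[OF assms(2)] assms(1)]]
    by simp
  finally show ?thesis
    using integral_hN[OF assms(2,3)] by (simp add: Dop_def Lop_def mult.commute)
qed

lemma lev_Lop: "lev N f \<Longrightarrow> lev N (Lop N f)"
  unfolding Lop_def[abs_def]
  by (intro lev_diff lev_mult lev_const lev_integral lev_hN') assumption+

lemma lev_Dop:
  assumes "lev N \<phi>" "N \<ge> 1"
  shows "lev N (Dop p m \<phi>)"
proof -
  have "lev N (\<lambda>x. - cp p * Lop N \<phi> x)"
    by (intro lev_mult lev_const lev_Lop assms)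
  then show ?thesis using Dop_eq_Lop[OF assms(1) _ assms(2)] by (simp add: lev_def)
qed

text \<open>Self-adjointness, from the symmetry of \<open>hN\<close> and the exchange of integrals;
  it moves D from the test function onto the Green's function.\<close>

lemma Lop_symmetric:
  assumes f: "lev N f" and g: "lev N g"
  shows "(\<integral>x. f x * Lop N g x \<partial>\<mu>) = (\<integral>x. Lop N f x * g x \<partial>\<mu>)"
proof -
  have lA: "lev N (\<lambda>x. \<integral>z. hN N x z * u z \<partial>\<mu>)" for u
    by (intro lev_integral lev_mult lev_const lev_hN') assumption
  have "(\<integral>x. f x * Lop N g x \<partial>\<mu>) =
      (\<integral>x. f x * (\<integral>z. hN N x z * g z \<partial>\<mu>) - rho N * (f x * g x) \<partial>\<mu>)"
    by (simp add: Lop_def algebra_simps)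
  also have "\<dots> = (\<integral>x. f x * (\<integral>z. hN N x z * g z \<partial>\<mu>) \<partial>\<mu>) - rho N * (\<integral>x. f x * g x \<partial>\<mu>)"
    using lev_integrable[OF lev_mult[OF f lA[of g]]] lev_integrable[OF lev_mult[OF f g]] by simp
  also have "(\<integral>x. f x * (\<integral>z. hN N x z * g z \<partial>\<mu>) \<partial>\<mu>) = (\<integral>x. \<integral>z. f x * (hN N x z * g z) \<partial>\<mu> \<partial>\<mu>)"
    by simp
  also have "\<dots> = (\<integral>z. \<integral>x. f x * (hN N x z * g z) \<partial>\<mu> \<partial>\<mu>)"
    by (rule lev_integral_swap[of N]) (intro lev_mult lev_const f g lev_hN lev_hN', assumption)+
  also have "\<dots> = (\<integral>z. (\<integral>x. hN N z x * f x \<partial>\<mu>) * g z \<partial>\<mu>)"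
  proof (rule Bochner_Integration.integral_cong[OF refl])
    fix z
    have "(\<integral>x. f x * (hN N x z * g z) \<partial>\<mu>) = (\<integral>x. (hN N z x * f x) * g z \<partial>\<mu>)"
      by (rule Bochner_Integration.integral_cong[OF refl]) (simp add: hN_sym[of N z])
    then show "(\<integral>x. f x * (hN N x z * g z) \<partial>\<mu>) = (\<integral>x. hN N z x * f x \<partial>\<mu>) * g z" by simp
  qed
  also have "\<dots> - rho N * (\<integral>x. f x * g x \<partial>\<mu>) = (\<integral>x. (\<integral>z. hN N x z * f z \<partial>\<mu>) * g x - rho N * (f x * g x) \<partial>\<mu>)"
    using lev_integrable[OF lev_mult[OF lA[of f] g]] lev_integrable[OF lev_mult[OF f g]] by simp
  also have "\<dots> = (\<integral>x. Lop N f x * g x \<partial>\<mu>)"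
    by (simp add: Lop_def algebra_simps)
  finally show ?thesis .
qed

lemma cp_eq: "cp p = P * (P - 1) / (P + 1)"
proof -
  have "cp p = P * (((P - 1) / P) * ((P - 1) / P)) / (((P - 1) / P) * ((P + 1) / P))"
    using p_gt_1 by (simp add: cp_def power2_eq_square field_simps)
  then show ?thesis using P_gt_1 by simp
qed

text \<open>\<open>P ^ N * ind N x y\<close> has integral 1 and stands for the delta at y. Both
  coefficients come out right because cp (P + 1) = P (P - 1).\<close>

lemma Lop_gN:
  assumes "x \<in> E" "y \<in> E" "N \<ge> 1"
  shows "- cp p * Lop N (\<lambda>z. gN N z y) x = P ^ N * ind N x y - 1 / volE p m"
proof -
  have c: "cp p * ((P + 1) / (P * (P - 1))) = 1"
    using P_gt_1 by (simp add: cp_eq)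
  have "cp p * ((P + 1) / (real m * (P - 1)\<^sup>2)) = cp p * ((P + 1) / (P * (P - 1))) * (P / (real m * (P - 1)))"
    using P_gt_1 by (simp add: power2_eq_square)
  also have "\<dots> = 1 / volE p m" unfolding c by (simp add: volE_def)
  finally have vol: "cp p * ((P + 1) / (real m * (P - 1)\<^sup>2)) = 1 / volE p m" .
  define K C where "K = (P + 1) / (P * (P - 1))" and "C = (P + 1) / (real m * (P - 1)\<^sup>2)"
  have L: "Lop N (\<lambda>z. gN N z y) x = C - P ^ N * ind N x y * K"
    by (simp add: Lop_def integral_hN_gN[OF assms] K_def C_def)
  have "- cp p * Lop N (\<lambda>z. gN N z y) x = P ^ N * ind N x y * (cp p * K) - cp p * C"
    unfolding L by (simp add: algebra_simps)
  then show ?thesis unfolding K_def C_def c vol by simp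
qed

lemma volE_pos: "volE p m > 0"
  using m_pos P_gt_1 by (simp add: volE_def)

lemma integral_gN_Dop:
  assumes "lev N \<phi>" "y \<in> E" "N \<ge> 1"
  shows "(\<integral>x. gN N x y * Dop p m \<phi> x \<partial>\<mu>) = \<phi> y - 1 / volE p m * (\<integral>x. \<phi> x \<partial>\<mu>)"
proof -
  have "(\<integral>x. gN N x y * Dop p m \<phi> x \<partial>\<mu>) = (\<integral>x. - cp p * (gN N x y * Lop N \<phi> x) \<partial>\<mu>)"
    using Dop_eq_Lop[OF assms(1) _ assms(3)]
    by (intro Bochner_Integration.integral_cong refl) simp
  also have "\<dots> = - cp p * (\<integral>x. Lop N (\<lambda>x. gN N x y) x * \<phi> x \<partial>\<mu>)"
    by (simp only: integral_mult_right_zero Lop_symmetric[OF lev_gN[OF assms(2)] assms(1)])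
  also have "\<dots> = (\<integral>x. (- cp p * Lop N (\<lambda>x. gN N x y) x) * \<phi> x \<partial>\<mu>)"
    by (simp only: integral_mult_right_zero mult.assoc)
  also have "\<dots> = (\<integral>x. P ^ N * (ind N y x * \<phi> x) - 1 / volE p m * \<phi> x \<partial>\<mu>)"
    using Lop_gN[OF _ assms(2,3)]
    by (intro Bochner_Integration.integral_cong refl) (simp add: ind_sym[of N y] algebra_simps)
  also have "\<dots> = P ^ N * (\<integral>x. ind N y x * \<phi> x \<partial>\<mu>) - 1 / volE p m * (\<integral>x. \<phi> x \<partial>\<mu>)"
    using lev_integrable[OF assms(1)] lev_integrable[OF lev_mult[OF lev_ind[OF order_refl assms(2)] assms(1)]]
    by simp
  also have "P ^ N * (\<integral>x. ind N y x * \<phi> x \<partial>\<mu>) = \<phi> y"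
    using integral_ind_mult[OF assms] p_gt_1 by simp
  finally show ?thesis .
qed

lemma lev_imp_loc_const: "lev N \<phi> \<Longrightarrow> loc_const p m \<phi>"
  unfolding loc_const_def
proof
  fix x assume N: "lev N \<phi>" and x: "x \<in> E"
  have "\<phi> z = \<phi> x" if "z \<in> E" "z (v x + Suc N) = x (v x + Suc N)" for z
    using rel_iff_eq[OF x that(1), of "Suc N"] that levD[OF lev_mono[OF N, of "Suc N"], of x z] x
    by simp
  then show "\<exists>n. \<forall>z\<in>E. z n = x n \<longrightarrow> \<phi> z = \<phi> x" by blast
qed

text \<open>Compactness of \<open>E\<close>, in the form of Koenig's lemma: a nested sequence of residue classes on
  which \<open>\<phi>\<close> has no uniform level would converge to a point of \<open>E\<close>.\<close>

lemma loc_const_imp_lev: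
  assumes "loc_const p m \<phi>"
  obtains N where "N \<ge> 1" "lev N \<phi>"
proof -
  define good where "good n c N \<longleftrightarrow>
      (\<forall>x\<in>E. \<forall>z\<in>E. x n = c \<longrightarrow> z n = c \<longrightarrow> x N = z N \<longrightarrow> \<phi> x = \<phi> z)" for n c N
  have "\<exists>N. good 0 0 N"
  proof (rule ccontr)
    assume bad0: "\<nexists>N. good 0 0 N"
    have "\<exists>f. \<forall>n. ((\<nexists>N. good n (f n) N) \<and> 0 \<le> f n \<and> f n < int p ^ n) \<and> f (Suc n) mod int p ^ n = f n"
    proof (rule dependent_nat_choice)
      show "\<exists>c. (\<nexists>N. good 0 c N) \<and> 0 \<le> c \<and> c < int p ^ 0"
        using bad0 by (intro exI[of _ 0]) simp
      fix c n assume c: "(\<nexists>N. good n c N) \<and> 0 \<le> c \<and> c < int p ^ n"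
      define S where "S = {c'\<in>{0..<int p ^ Suc n}. c' mod int p ^ n = c}"
      have finS: "finite S"
        by (rule finite_subset[of _ "{0..<int p ^ Suc n}"]) (auto simp: S_def)
      show "\<exists>c'. ((\<nexists>N. good (Suc n) c' N) \<and> 0 \<le> c' \<and> c' < int p ^ Suc n) \<and> c' mod int p ^ n = c"
      proof (rule ccontr)
        assume "\<not> ?thesis"
        then have "\<forall>c'\<in>S. \<exists>N. good (Suc n) c' N" unfolding S_def by auto
        then obtain M where M: "\<forall>c'\<in>S. good (Suc n) c' (M c')" by metis
        \<comment> \<open>The sum dominates the levels of all the finitely many subclasses;
          \<open>Suc n\<close> ensures that agreement at N puts x and z into the same
          subclass.\<close>
        define N where "N = Suc n + (\<Sum>c'\<in>S. M c')"
        have "good n c N"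
          unfolding good_def
        proof (intro ballI impI)
          fix x z assume xz: "x \<in> E" "z \<in> E" "x n = c" "z n = c" "x N = z N"
          have S: "x (Suc n) \<in> S"
            using Zp_bounds[OF E_Zp[OF xz(1)], of "Suc n"] Zp_mod[OF E_Zp[OF xz(1)], of n "Suc n"] xz(3)
            by (simp add: S_def)
          have "M (x (Suc n)) \<le> N"
            using member_le_sum[OF S, of M] finS by (simp add: N_def)
          then have "x (M (x (Suc n))) = z (M (x (Suc n)))"
            using Zp_eq_mono[of x z N "M (x (Suc n))"] xz E_Zp by blast
          moreover have "z (Suc n) = x (Suc n)"
            using Zp_eq_mono[of x z N "Suc n"] xz E_Zp by (simp add: N_def)
          ultimately show "\<phi> x = \<phi> z"
            using bspec[OF M S] xz(1,2) unfolding good_def by blast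
        qed
        then show False using c by blast
      qed
    qed
    then obtain f where f: "\<forall>n. ((\<nexists>N. good n (f n) N) \<and> 0 \<le> f n \<and> f n < int p ^ n) \<and> f (Suc n) mod int p ^ n = f n"
      by (rule exE)
    have bad: "\<not> good n (f n) N" for n N using spec[OF f, of n] by simp
    have fZ: "f \<in> Zp p" using f by (simp add: Zp_def)
    show False
    proof (cases "f m = 0")
      \<comment> \<open>The limit lies in p^m Z_p, which misses E, so its class modulo p^m is
        vacuously good.\<close>
      case True
      have "x m \<noteq> 0" if "x \<in> E" for x
        using E_zero_iff[OF that, of m] E_val[OF that] by simp
      then have "good m (f m) 0"
        unfolding good_def True by blast
      then show False using bad by simp
    next
      case False
      then have "f \<in> E" using fZ E_I by blast
      then obtain n where "\<forall>z\<in>E. z n = f n \<longrightarrow> \<phi> z = \<phi> f"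
        using assms unfolding loc_const_def by blast
      then have "good n (f n) 0" unfolding good_def by simp
      then show False using bad by simp
    qed
  qed
  then obtain N where N: "good 0 0 N" by blast
  have "lev N \<phi>"
  proof (rule levI)
    fix x z assume "x \<in> E" "z \<in> E" "rel N x z"
    then show "\<phi> x = \<phi> z"
      using N rel_coord[of N x z] Zp_at_0 E_Zp unfolding good_def by blast
  qed
  then have "lev (Suc N) \<phi>" by (rule lev_mono) simp
  then show ?thesis by (intro that[of "Suc N"]) simp_all
qed

section \<open>The weak equation and uniqueness\<close>

lemma measurable_rel:
  "Measurable.pred (\<mu> \<Otimes>\<^sub>M \<mu>) (\<lambda>z. rel k (fst z) (snd z))"
proof -
  have v1: "(\<lambda>z. v (fst z)) \<in> \<mu> \<Otimes>\<^sub>M \<mu> \<rightarrow>\<^sub>M count_space UNIV"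
    and v2: "(\<lambda>z. v (snd z)) \<in> \<mu> \<Otimes>\<^sub>M \<mu> \<rightarrow>\<^sub>M count_space UNIV"
    and c1: "(\<lambda>z. fst z n) \<in> \<mu> \<Otimes>\<^sub>M \<mu> \<rightarrow>\<^sub>M count_space UNIV"
    and c2: "(\<lambda>z. snd z n) \<in> \<mu> \<Otimes>\<^sub>M \<mu> \<rightarrow>\<^sub>M count_space UNIV" for n
    by (rule measurable_compose[OF measurable_fst measurable_val_mstar]
        measurable_compose[OF measurable_snd measurable_val_mstar]
        measurable_compose[OF measurable_fst measurable_coord_mstar]
        measurable_compose[OF measurable_snd measurable_coord_mstar])+
  have e: "Measurable.pred (\<mu> \<Otimes>\<^sub>M \<mu>) (\<lambda>z. fst z (i + k) = snd z (i + k))" for i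
    by (rule measurable_countable_binop[OF c1 c2, where h = "(=)"])
  \<comment> \<open>The index of the compared residue depends on the point, so the countably many
    values of \<open>v\<close> are treated separately.\<close>
  have 1: "Measurable.pred (\<mu> \<Otimes>\<^sub>M \<mu>) (\<lambda>z. fst z (v (fst z) + k) = snd z (v (fst z) + k))"
    by (rule measurable_compose_countable[OF e v1])
  have 2: "Measurable.pred (\<mu> \<Otimes>\<^sub>M \<mu>) (\<lambda>z. v (fst z) = v (snd z))"
    by (rule measurable_countable_binop[OF v1 v2, where h = "(=)"])
  show ?thesis unfolding rel_def using 2 1 by (rule pred_intros_logic)
qed

lemma measurable_Green:
  "(\<lambda>z. Green p m (fst z) (snd z)) \<in> borel_measurable (\<mu> \<Otimes>\<^sub>M \<mu>)"
proof -
  have v1: "(\<lambda>z. v (fst z)) \<in> \<mu> \<Otimes>\<^sub>M \<mu> \<rightarrow>\<^sub>M count_space UNIV"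
    and v2: "(\<lambda>z. v (snd z)) \<in> \<mu> \<Otimes>\<^sub>M \<mu> \<rightarrow>\<^sub>M count_space UNIV"
    by (rule measurable_compose[OF measurable_fst measurable_val_mstar]
        measurable_compose[OF measurable_snd measurable_val_mstar])+
  have "(\<lambda>z. int (v (fst z)) - int (v (snd z))) \<in> \<mu> \<Otimes>\<^sub>M \<mu> \<rightarrow>\<^sub>M count_space UNIV"
    by (rule measurable_countable_binop[OF v1 v2])
  then have 1: "(\<lambda>z. gg (int (v (fst z)) - int (v (snd z)))) \<in> borel_measurable (\<mu> \<Otimes>\<^sub>M \<mu>)"
    by (rule measurable_compose) simp
  have "Measurable.pred (\<mu> \<Otimes>\<^sub>M \<mu>) (\<lambda>z. \<not> rel (Suc k) (fst z) (snd z))" for k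
    using measurable_rel[of "Suc k"] by (rule pred_intros_logic)
  then have "(\<lambda>z. prox (fst z) (snd z)) \<in> \<mu> \<Otimes>\<^sub>M \<mu> \<rightarrow>\<^sub>M count_space UNIV"
    unfolding prox_def by (rule measurable_Least)
  then have 2: "(\<lambda>z. real (prox (fst z) (snd z))) \<in> borel_measurable (\<mu> \<Otimes>\<^sub>M \<mu>)"
    by (rule measurable_compose) simp
  have "(\<lambda>z. gg (int (v (fst z)) - int (v (snd z))) + real (prox (fst z) (snd z)))
      \<in> borel_measurable (\<mu> \<Otimes>\<^sub>M \<mu>)"
    using 1 2 by (rule borel_measurable_add)
  then show ?thesis
    by (rule measurable_cong[THEN iffD1, rotated]) (auto simp: space_pair_measure Green_eq)
qed

lemma measurable_Green_section:
  assumes "y \<in> E" shows "(\<lambda>x. Green p m x y) \<in> borel_measurable \<mu>"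
proof -
  have "(\<lambda>x. (x, y)) \<in> \<mu> \<rightarrow>\<^sub>M \<mu> \<Otimes>\<^sub>M \<mu>"
    using assms by (intro measurable_Pair2') simp
  from measurable_compose[OF this measurable_Green] show ?thesis by simp
qed

text \<open>The balls around y shrink to y and their volumes 1/P^k tend to 0. So the unspecified
  value of \<open>Green\<close> on the diagonal affects no integral.\<close>

lemma AE_neq:
  assumes "y \<in> E" shows "AE x in \<mu>. x \<noteq> y"
proof (rule AE_I[of _ _ "\<Inter>k\<in>{1..}. {z \<in> E. rel k y z}"])
  let ?N = "\<Inter>k\<in>{1..}. {z \<in> E. rel k y z}"
  show sets: "?N \<in> sets \<mu>"
    using ball_sets[OF assms] by (intro sets.countable_INT') auto
  show "{x \<in> space \<mu>. \<not> x \<noteq> y} \<subseteq> ?N" using assms by auto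
  have le: "measure \<mu> ?N \<le> (1 / P) ^ k" if "k \<ge> 1" for k
  proof -
    have "measure \<mu> ?N \<le> measure \<mu> {z \<in> E. rel k y z}"
      using ball_sets[OF assms that] that by (intro mu.finite_measure_mono) auto
    then show ?thesis using measure_ball[OF assms that] by (simp add: power_one_over)
  qed
  have "measure \<mu> ?N = 0"
  proof (rule ccontr)
    assume "measure \<mu> ?N \<noteq> 0"
    then have "measure \<mu> ?N > 0" using measure_nonneg[of \<mu> ?N] by linarith
    then obtain k where k: "(1 / P) ^ k < measure \<mu> ?N"
      using real_arch_pow_inv[of "measure \<mu> ?N" "1 / P"] P_gt_1 by auto
    have "(1 / P) ^ Suc k \<le> (1 / P) ^ k"
      using P_gt_1 by (intro power_decreasing) auto
    then show False using k le[of "Suc k"] by simp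
  qed
  then show "emeasure \<mu> ?N = 0" by (simp add: mu.emeasure_eq_measure)
qed

text \<open>\<open>prox x y\<close> counts the levels k \<ge> 1 whose balls contain both points.
  Splitting the count at N separates the part that \<open>gN\<close> keeps exactly from the tail
  that it averages.\<close>

lemma sum_ind_tail:
  assumes "x \<in> E" "y \<in> E" "x \<noteq> y" "N \<ge> 1"
  shows "summable (\<lambda>k. ind (N + k) x y)"
    and "(\<Sum>k=1..<N. ind k x y) + (\<Sum>k. ind (N + k) x y) = real (prox x y)"
proof -
  define r where "r = prox x y"
  have r: "ind k x y = (if k \<le> r then 1 else 0)" if "k \<ge> 1" for k
    using rel_iff_prox[OF assms(1-3) that] by (simp add: ind_def r_def)
  have fin: "(\<lambda>k. ind (N + k) x y) sums (\<Sum>k\<in>{..<Suc r - N}. ind (N + k) x y)"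
    using r assms(4) by (intro sums_finite) auto
  then show "summable (\<lambda>k. ind (N + k) x y)" by (rule sums_summable)
  have "(\<Sum>k\<in>{..<Suc r - N}. ind (N + k) x y) = (\<Sum>k\<in>{..<Suc r - N}. 1)"
    using r assms(4) by (intro sum.cong) auto
  then have tail: "(\<Sum>k. ind (N + k) x y) = real (Suc r - N)"
    using sums_unique[OF fin] by simp
  have "(\<Sum>k=1..<N. ind k x y) = (\<Sum>k=1..<N. if k \<le> r then 1 else 0)"
    using r by (intro sum.cong) auto
  also have "\<dots> = (\<Sum>k\<in>{k\<in>{1..<N}. k \<le> r}. 1)"
    by (rule sum.inter_filter[symmetric]) simp
  also have "{k\<in>{1..<N}. k \<le> r} = {1..<min N (Suc r)}" by auto
  also have "(\<Sum>k\<in>\<dots>. 1) = real (min N (Suc r) - 1)" by simp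
  finally have head: "(\<Sum>k=1..<N. ind k x y) = real (min N (Suc r) - 1)" .
  have "(min N (Suc r) - 1) + (Suc r - N) = r" using assms(4) by simp
  then show "(\<Sum>k=1..<N. ind k x y) + (\<Sum>k. ind (N + k) x y) = real (prox x y)"
    unfolding head tail r_def[symmetric] by (simp flip: of_nat_add)
qed

text \<open>The logarithmic singularity is a series of ball indicators with integrals 1/P^(N + k).
  Their sum is P/(P - 1) times the volume of the level N ball, which is the integral of the last
  term of \<open>gN\<close>.\<close>

lemma Green_average:
  assumes "lev N \<psi>" "y \<in> E" "N \<ge> 1"
  shows "has_bochner_integral \<mu> (\<lambda>x. Green p m x y * \<psi> x) (\<integral>x. gN N x y * \<psi> x \<partial>\<mu>)"
proof -
  define T where "T x = (\<Sum>k. ind (N + k) y x)" for x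
  have int: "has_bochner_integral \<mu> (ind (N + k) y) (1 / P ^ (N + k))" for k
    using assms by (intro has_integral_ind) auto
  have norm: "norm (ind k y x) = ind k y x" for k x by (simp add: ind_def)
  have geo: "(\<lambda>k. 1 / P ^ (N + k)) sums (1 / P ^ N * (P / (P - 1)))"
  proof -
    have "(\<lambda>k. 1 / P ^ N * (1 / P) ^ k) sums (1 / P ^ N * (1 / (1 - 1 / P)))"
      using P_gt_1 by (intro sums_mult geometric_sums) simp
    moreover have "1 / (1 - 1 / P) = P / (P - 1)" using P_gt_1 by (simp add: field_simps)
    ultimately show ?thesis by (simp add: power_add power_one_over)
  qed
  have ae: "AE x in \<mu>. summable (\<lambda>k. norm (ind (N + k) y x))"
    using AE_neq[OF assms(2)] AE_space
  proof eventually_elim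
    case (elim x)
    then show ?case
      using sum_ind_tail(1)[of y x N] assms by (simp add: norm del: real_norm_def)
  qed
  have intT: "integrable \<mu> T" "(\<integral>x. T x \<partial>\<mu>) = 1 / P ^ N * (P / (P - 1))"
  proof -
    have eq: "integral\<^sup>L \<mu> (ind (N + k) y) = 1 / P ^ (N + k)" "integrable \<mu> (ind (N + k) y)" for k
      using int[of k] by (simp_all add: has_bochner_integral_iff)
    have summ: "summable (\<lambda>k. \<integral>x. norm (ind (N + k) y x) \<partial>\<mu>)"
      unfolding norm eq using geo by (rule sums_summable)
    show "integrable \<mu> T"
      unfolding T_def[abs_def] using eq(2) ae summ by (rule integrable_suminf)
    show "(\<integral>x. T x \<partial>\<mu>) = 1 / P ^ N * (P / (P - 1))"
      unfolding T_def using integral_suminf[OF eq(2) ae summ] sums_unique[OF geo] by (simp add: eq(1))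
  qed
  \<comment> \<open>The tail and the last term of \<open>gN\<close> live on the level N ball of y,
    where \<psi> equals \<psi> y. So F agrees with \<open>Green\<close> times \<psi> almost
    everywhere, and its correction term integrates to 0.\<close>
  define F where "F x = gN N x y * \<psi> x + \<psi> y * (T x - P / (P - 1) * ind N y x)" for x
  have F1: "integrable \<mu> (\<lambda>x. gN N x y * \<psi> x)" "integrable \<mu> (ind N y)"
    by (rule lev_integrable lev_mult lev_gN lev_ind assms order_refl)+
  have "integrable \<mu> F"
    unfolding F_def[abs_def] using F1 intT(1) by simp
  moreover have "integral\<^sup>L \<mu> F = (\<integral>x. gN N x y * \<psi> x \<partial>\<mu>)"
    unfolding F_def[abs_def] using F1 intT has_integral_ind[OF assms(2,3)]
    by (simp add: has_bochner_integral_iff)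
  ultimately have F: "has_bochner_integral \<mu> F (\<integral>x. gN N x y * \<psi> x \<partial>\<mu>)"
    by (simp add: has_bochner_integral_iff)
  have "AE x in \<mu>. Green p m x y * \<psi> x = F x"
    using AE_neq[OF assms(2)] AE_space
  proof eventually_elim
    case (elim x)
    then have x: "x \<in> E" "x \<noteq> y" by auto
    have T: "T x = (\<Sum>k. ind (N + k) x y)" unfolding T_def by (simp add: ind_sym[of _ y])
    have G: "Green p m x y = gN N x y + (T x - P / (P - 1) * ind N y x)"
      using sum_ind_tail(2)[OF x(1) assms(2) x(2) assms(3)] Green_eq[OF x(1) assms(2)]
      by (simp add: gN_def T ind_sym[of N y])
    show ?case
    proof (cases "rel N y x")
      case True
      have "(a + b) * c = a * c + c * b" for a b c :: real by (simp add: algebra_simps)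
      then show ?thesis unfolding F_def G levD[OF assms(1) True assms(2) x(1)] .
    next
      case False
      have "ind (N + k) y x = 0" for k
        using False rel_mono[of "N + k" y x N] x assms(2) by (auto simp: ind_def)
      then have "T x = 0" "ind N y x = 0" using False by (simp_all add: T_def ind_def)
      then show ?thesis using G by (simp add: F_def)
    qed
  qed
  moreover have "(\<lambda>x. Green p m x y * \<psi> x) \<in> borel_measurable \<mu>"
    by (intro borel_measurable_times measurable_Green_section borel_measurable_integrable lev_integrable assms)
       (rule assms)
  moreover have "F \<in> borel_measurable \<mu>" using F by (rule borel_measurable_has_bochner_integral)
  ultimately show ?thesis
    using F by (subst has_bochner_integral_cong_AE) auto
qed

text \<open>\<open>Dop p m \<phi>\<close> has the same level as \<open>\<phi>\<close>, so
  \<open>Green\<close> may be replaced by \<open>gN\<close> at that level.\<close>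

lemma is_green_Green: "is_green p m (Green p m)"
  unfolding is_green_def
proof (intro ballI allI impI)
  fix y \<phi> assume y: "y \<in> E" and "loc_const p m \<phi>"
  then obtain N where N: "N \<ge> 1" "lev N \<phi>" using loc_const_imp_lev by blast
  show "integrable \<mu> (\<lambda>x. Green p m x y * Dop p m \<phi> x) \<and>
      (\<integral>x. Green p m x y * Dop p m \<phi> x \<partial>\<mu>) = \<phi> y - 1 / volE p m * (\<integral>x. \<phi> x \<partial>\<mu>)"
    using Green_average[OF lev_Dop[OF N(2,1)] y N(1)] integral_gN_Dop[OF N(2) y N(1)]
    by (simp add: has_bochner_integral_iff)
qed

section \<open>Functions orthogonal to the range of D\<close>

lemma integrable_lev_mult:
  assumes "lev N g" "integrable \<mu> f"
  shows "integrable \<mu> (\<lambda>x. g x * f x)"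
proof -
  obtain W where W: "finite W" "W \<subseteq> E" "\<forall>x\<in>E. \<exists>!w. w \<in> W \<and> rel N w x"
    using finite_classes[of N] by blast
  have bound: "\<bar>g x\<bar> \<le> (\<Sum>w\<in>W. \<bar>g w\<bar>)" if x: "x \<in> E" for x
  proof -
    obtain w where w: "w \<in> W" "rel N w x" using bspec[OF W(3) x] by blast
    then have "g x = g w" using levD[OF assms(1) w(2)] W(2) x by auto
    then show ?thesis using member_le_sum[OF w(1), of "\<lambda>w. \<bar>g w\<bar>"] W(1) by simp
  qed
  show ?thesis
  proof (rule Bochner_Integration.integrable_bound[of _ "\<lambda>x. (\<Sum>w\<in>W. \<bar>g w\<bar>) * f x"])
    show "integrable \<mu> (\<lambda>x. (\<Sum>w\<in>W. \<bar>g w\<bar>) * f x)" using assms(2) by simp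
    show "(\<lambda>x. g x * f x) \<in> borel_measurable \<mu>"
      by (intro borel_measurable_times borel_measurable_integrable lev_integrable assms) (rule assms)
    show "AE x in \<mu>. norm (g x * f x) \<le> norm ((\<Sum>w\<in>W. \<bar>g w\<bar>) * f x)"
    proof (rule AE_I2)
      fix x assume "x \<in> space \<mu>"
      then have "\<bar>g x\<bar> \<le> \<bar>\<Sum>w\<in>W. \<bar>g w\<bar>\<bar>" using bound[of x] by simp
      then show "norm (g x * f x) \<le> norm ((\<Sum>w\<in>W. \<bar>g w\<bar>) * f x)"
        by (simp add: abs_mult mult_right_mono)
    qed
  qed
qed

definition balls :: "(nat \<Rightarrow> int) set set" where
  "balls = insert {} {{z \<in> E. rel N w z} |N w. N \<ge> 1 \<and> w \<in> E}"

text \<open>By the ultrametric property two balls with a common point are nested; the empty set in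
  \<open>balls\<close> covers the disjoint case.\<close>

lemma Int_stable_balls: "Int_stable balls"
proof (rule Int_stableI)
  fix A B assume "A \<in> balls" "B \<in> balls"
  then consider "A \<inter> B = {}" | N w M u where "N \<ge> 1" "M \<ge> 1" "w \<in> E" "u \<in> E"
      "A = {z \<in> E. rel N w z}" "B = {z \<in> E. rel M u z}"
    unfolding balls_def by blast
  then show "A \<inter> B \<in> balls"
  proof cases
    case 1
    then show ?thesis by (simp add: balls_def)
  next
    case 2
    have nest: "{z \<in> E. rel M u z} \<subseteq> {z \<in> E. rel N w z}"
      if "N \<le> M" "x \<in> E" "rel N w x" "rel M u x" "u \<in> E" for N M w u x
    proof (intro subsetI CollectI conjI)
      fix z assume z: "z \<in> {z \<in> E. rel M u z}"
      then show "z \<in> E" by simp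
      have "rel M x z" using z that(4) rel_sym[of M u x] rel_trans[of M x u z] by blast
      then have "rel N x z" using rel_mono that(1,2) z by blast
      then show "rel N w z" using that(3) rel_trans by blast
    qed
    have "A \<inter> B = {} \<or> A \<subseteq> B \<or> B \<subseteq> A"
    proof (cases "A \<inter> B = {}")
      case False
      then obtain x where x: "x \<in> E" "rel N w x" "rel M u x" using 2 by auto
      show ?thesis
        using nest[OF _ x(1,2,3) 2(4)] nest[OF _ x(1,3,2) 2(3)] 2(5,6) nat_le_linear[of N M] by blast
    qed simp
    then have "A \<inter> B = {} \<or> A \<inter> B = A \<or> A \<inter> B = B" by blast
    then show ?thesis using \<open>A \<in> balls\<close> \<open>B \<in> balls\<close> by (auto simp: balls_def)
  qed
qed

lemma balls_subset: "balls \<subseteq> Pow E"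
  by (auto simp: balls_def)

text \<open>The coordinates generate the sigma-algebra, and coordinate n is constant on each of the
  finitely many balls of level \<open>Suc n\<close>. The successor keeps the level positive at n =
  0.\<close>

lemma sets_mstar_subset_balls: "sets \<mu> \<subseteq> sigma_sets E balls"
proof -
  let ?M = "sigma E balls"
  have sp: "space ?M = E" and se: "sets ?M = sigma_sets E balls"
    using balls_subset by simp_all
  have "(\<lambda>x n. x n) \<in> ?M \<rightarrow>\<^sub>M seq_algebra"
  proof (rule measurable_PiM_single')
    fix n :: nat
    show "(\<lambda>x. x n) \<in> ?M \<rightarrow>\<^sub>M count_space (UNIV :: int set)"
    proof (rule measurableI)
      fix A :: "int set"
      obtain W where W: "finite W" "W \<subseteq> E" "\<forall>x\<in>E. \<exists>!w. w \<in> W \<and> rel (Suc n) w x"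
        using finite_classes[of "Suc n"] by blast
      have co: "w n = x n" if "rel (Suc n) w x" "w \<in> E" "x \<in> E" for w x
        using rel_coord[OF rel_mono[OF that(1), of n]] that by simp
      have "(\<lambda>x. x n) -` A \<inter> E = (\<Union>w\<in>{w\<in>W. w n \<in> A}. {z \<in> E. rel (Suc n) w z})"
      proof (intro equalityI subsetI)
        fix x assume x: "x \<in> (\<lambda>x. x n) -` A \<inter> E"
        then obtain w where w: "w \<in> W" "rel (Suc n) w x" using bspec[OF W(3), of x] by blast
        then have "w n = x n" using co W(2) x by blast
        then show "x \<in> (\<Union>w\<in>{w\<in>W. w n \<in> A}. {z \<in> E. rel (Suc n) w z})" using w x by auto
      next
        fix x assume "x \<in> (\<Union>w\<in>{w\<in>W. w n \<in> A}. {z \<in> E. rel (Suc n) w z})"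
        then obtain w where w: "w \<in> W" "w n \<in> A" "x \<in> E" "rel (Suc n) w x" by blast
        then have "w n = x n" using co W(2) by blast
        then show "x \<in> (\<lambda>x. x n) -` A \<inter> E" using w by simp
      qed
      also have "\<dots> \<in> sets ?M"
      proof (rule sets.finite_UN)
        fix w assume "w \<in> {w\<in>W. w n \<in> A}"
        then have "{z \<in> E. rel (Suc n) w z} \<in> balls" using W(2) by (auto simp: balls_def)
        then show "{z \<in> E. rel (Suc n) w z} \<in> sets ?M" unfolding se by (rule sigma_sets.Basic)
      qed (use W(1) in simp)
      finally show "(\<lambda>x. x n) -` A \<inter> space ?M \<in> sets ?M" by (simp only: sp)
    qed simp
  qed (simp add: space_PiM)
  then have id: "(\<lambda>x. x) \<in> ?M \<rightarrow>\<^sub>M haar p"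
    by (simp add: measurable_cong_sets[OF refl sets_haar])
  show ?thesis
  proof
    fix A assume "A \<in> sets \<mu>"
    then obtain B where B: "B \<in> sets (haar p)" "A = E \<inter> B"
      unfolding sets_mstar by (auto simp: sets_restrict_space)
    have "(\<lambda>x. x) -` B \<inter> space ?M \<in> sets ?M" using id B(1) by (rule measurable_sets)
    then show "A \<in> sigma_sets E balls" unfolding B(2) sp se by (simp add: Int_commute)
  qed
qed

text \<open>The sets over which f integrates to 0 form a Dynkin system containing the balls; the
  vanishing total integral settles complements.\<close>

lemma AE_zero_of_ball_integrals:
  assumes f: "integrable \<mu> f" and "(\<integral>x. f x \<partial>\<mu>) = 0"
    and ball: "\<And>N w. N \<ge> 1 \<Longrightarrow> w \<in> E \<Longrightarrow> (\<integral>x. ind N w x * f x \<partial>\<mu>) = 0"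
  shows "AE x in \<mu>. f x = 0"
proof (rule density_unique_real[of _ f "\<lambda>_. 0"])
  fix A assume "A \<in> sets \<mu>"
  then have A: "A \<in> sigma_sets E balls" using sets_mstar_subset_balls by blast
  have sub: "sigma_sets E balls \<subseteq> sets \<mu>"
    using sets.sigma_sets_subset[of balls \<mu>] ball_sets by (force simp: balls_def)
  have "(\<integral>x\<in>A. f x \<partial>\<mu>) = 0"
    using Int_stable_balls balls_subset A
  proof (induction rule: sigma_sets_induct_disjoint)
    case (basic B)
    then consider "B = {}" | N w where "N \<ge> 1" "w \<in> E" "B = {z \<in> E. rel N w z}"
      unfolding balls_def by blast
    then show ?case
    proof cases
      case (2 N w)
      have "(\<integral>x\<in>B. f x \<partial>\<mu>) = (\<integral>x. ind N w x * f x \<partial>\<mu>)"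
        unfolding set_lebesgue_integral_def
        by (rule Bochner_Integration.integral_cong[OF refl]) (auto simp: 2 ind_def indicator_def)
      then show ?thesis using ball 2 by simp
    qed (simp add: set_lebesgue_integral_def)
  next
    case (compl B)
    then have B: "B \<in> sets \<mu>" using sub by blast
    have iB: "integrable \<mu> (\<lambda>x. indicator B x *\<^sub>R f x)"
      using B f by (rule integrable_mult_indicator)
    have "(\<integral>x\<in>(E - B). f x \<partial>\<mu>) = (\<integral>x. f x - indicator B x *\<^sub>R f x \<partial>\<mu>)"
      unfolding set_lebesgue_integral_def
      by (rule Bochner_Integration.integral_cong[OF refl]) (auto simp: indicator_def)
    also have "\<dots> = (\<integral>x. f x \<partial>\<mu>) - (\<integral>x\<in>B. f x \<partial>\<mu>)"
      unfolding set_lebesgue_integral_def using f iB by (rule Bochner_Integration.integral_diff)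
    finally show ?case using compl assms(2) by simp
  next
    case (union B)
    have "(\<integral>x\<in>(\<Union>i. B i). f x \<partial>\<mu>) = (\<Sum>i. (\<integral>x\<in>B i. f x \<partial>\<mu>))"
    proof (rule lebesgue_integral_countable_add)
      show "B i \<in> sets \<mu>" for i using union(2) sub by blast
      then show "set_integrable \<mu> (\<Union>i. B i) f"
        unfolding set_integrable_def using f by (intro integrable_mult_indicator) auto
      show "i \<noteq> j \<Longrightarrow> B i \<inter> B j = {}" for i j using union(1) by (auto simp: disjoint_family_on_def)
    qed
    then show ?case using union by simp
  qed (simp add: set_lebesgue_integral_def)
  then show "(\<integral>x\<in>A. f x \<partial>\<mu>) = (\<integral>x\<in>A. 0 \<partial>\<mu>)" by (simp add: set_lebesgue_integral_def)
qed (use f in auto)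

text \<open>By \<open>Lop_gN\<close> the range of D contains every normalised ball indicator minus
  its mean. Orthogonality to these makes all ball averages of K equal to its global mean.\<close>

lemma AE_const_of_orthogonal:
  assumes K: "\<And>\<phi>. loc_const p m \<phi> \<Longrightarrow>
      integrable \<mu> (\<lambda>x. K x * Dop p m \<phi> x) \<and> (\<integral>x. K x * Dop p m \<phi> x \<partial>\<mu>) = 0"
  shows "AE x in \<mu>. K x = 1 / volE p m * (\<integral>x. K x \<partial>\<mu>)"
proof (cases "E = {}")
  case True
  then show ?thesis by (intro AE_I2) simp
next
  case False
  define V where "V = volE p m"
  have V: "V > 0" using volE_pos by (simp add: V_def)
  define u where "u N w x = P ^ N * ind N w x - 1 / V" for N w x
  have lev_u: "lev N (u N w)" if "w \<in> E" for N w
    unfolding u_def[abs_def] using that by (intro lev_intros) auto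
  have D: "integrable \<mu> (\<lambda>x. K x * u N w x)" "(\<integral>x. K x * u N w x \<partial>\<mu>) = 0"
    if "w \<in> E" "N \<ge> 1" for N w
  proof -
    have g: "lev N (\<lambda>z. gN N z w)" by (rule lev_gN[OF that(1)])
    have "Dop p m (\<lambda>z. gN N z w) x = u N w x" if "x \<in> E" for x
      using Dop_eq_Lop[OF g that \<open>N \<ge> 1\<close>] Lop_gN[OF that \<open>w \<in> E\<close> \<open>N \<ge> 1\<close>]
      by (simp add: u_def V_def ind_sym[of N w])
    then have "integrable \<mu> (\<lambda>x. K x * u N w x) = integrable \<mu> (\<lambda>x. K x * Dop p m (\<lambda>z. gN N z w) x)"
      "(\<integral>x. K x * u N w x \<partial>\<mu>) = (\<integral>x. K x * Dop p m (\<lambda>z. gN N z w) x \<partial>\<mu>)"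
      by (auto intro!: Bochner_Integration.integrable_cong Bochner_Integration.integral_cong)
    then show "integrable \<mu> (\<lambda>x. K x * u N w x)" "(\<integral>x. K x * u N w x \<partial>\<mu>) = 0"
      using K[OF lev_imp_loc_const[OF g]] by simp_all
  qed
  obtain y where y: "y \<in> E" using False by blast
  \<comment> \<open>So far only products of K with functions in the range of D are integrable.
    \<open>u 2 y\<close> takes only the values P^2 - 1/V and -1/V, both nonzero, so it can be
    divided out. Level 1 would fail for p = 2, m = 1, where P V = 1.\<close>
  have intK: "integrable \<mu> K"
  proof -
    have "P\<^sup>2 * V = real m * (P * (P - 1))"
      using p_gt_1 by (simp add: V_def volE_def power2_eq_square)
    moreover have "P * (P - 1) \<ge> 2 * 1"
      using p_gt_1 by (intro mult_mono) auto
    moreover have "real m * (P * (P - 1)) \<ge> 1 * (P * (P - 1))"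
      using m_pos p_gt_1 by (intro mult_right_mono) auto
    ultimately have "P\<^sup>2 * V > 1" by linarith
    then have nz: "u 2 y x \<noteq> 0" for x
      using V by (auto simp: u_def ind_def field_simps)
    have "lev 2 (\<lambda>x. 1 / u 2 y x)"
      using levD[OF lev_u[OF y, of 2]] by (intro levI arg_cong2[where f = "(/)"] refl) blast
    from integrable_lev_mult[OF this D(1)[OF y, of 2]] show ?thesis
      using nz by (simp add: mult.commute)
  qed
  define C where "C = 1 / V * (\<integral>x. K x \<partial>\<mu>)"
  have "AE x in \<mu>. K x - C = 0"
  proof (rule AE_zero_of_ball_integrals)
    show "integrable \<mu> (\<lambda>x. K x - C)" using intK by simp
    have "(\<integral>x. K x - C \<partial>\<mu>) = (\<integral>x. K x \<partial>\<mu>) - C * V"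
      using intK measure_E by (simp add: V_def mult.commute)
    then show "(\<integral>x. K x - C \<partial>\<mu>) = 0" using V by (simp add: C_def)
    fix N :: nat and w assume N: "N \<ge> 1" and w: "w \<in> E"
    have iK: "integrable \<mu> (\<lambda>x. ind N w x * K x)"
      by (rule integrable_lev_mult[OF lev_ind[OF order_refl w] intK])
    have "0 = (\<integral>x. P ^ N * (ind N w x * K x) - 1 / V * K x \<partial>\<mu>)"
      using D(2)[OF w N] by (simp add: u_def algebra_simps)
    also have "\<dots> = P ^ N * (\<integral>x. ind N w x * K x \<partial>\<mu>) - C"
      using iK intK by (simp add: C_def)
    finally have *: "(\<integral>x. ind N w x * K x \<partial>\<mu>) = C / P ^ N"
      using p_gt_1 by (simp add: field_simps)
    have "(\<integral>x. ind N w x * (K x - C) \<partial>\<mu>) = (\<integral>x. ind N w x * K x - C * ind N w x \<partial>\<mu>)"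
      by (simp add: algebra_simps)
    also have "\<dots> = C / P ^ N - C * (1 / P ^ N)"
      using iK has_integral_ind[OF w N] * by (simp add: has_bochner_integral_iff)
    finally show "(\<integral>x. ind N w x * (K x - C) \<partial>\<mu>) = 0" by simp
  qed
  then show ?thesis by (simp add: C_def V_def)
qed

sublocale mu_pair: pair_sigma_finite \<mu> \<mu> ..

lemma AE_nonempty: "AE x in \<mu>. Q x \<Longrightarrow> \<exists>x\<in>E. Q x"
proof (rule ccontr)
  assume Q: "AE x in \<mu>. Q x" and "\<not> (\<exists>x\<in>E. Q x)"
  then have "emeasure \<mu> E = 0" using AE_E2[OF Q] by (simp cong: conj_cong)
  then show False using measure_E volE_pos by (simp add: measure_def)
qed

lemma Green_unique:
  assumes sym: "\<forall>x\<in>E. \<forall>y\<in>E. G' x y = G' y x"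
    and meas: "(\<lambda>z. G' (fst z) (snd z)) \<in> borel_measurable (\<mu> \<Otimes>\<^sub>M \<mu>)"
    and green: "is_green p m G'"
  shows "\<exists>c. AE z in \<mu> \<Otimes>\<^sub>M \<mu>. G' (fst z) (snd z) = Green p m (fst z) (snd z) + c"
proof -
  define K where "K x y = G' x y - Green p m x y" for x y
  \<comment> \<open>Integrating over the second argument makes C measurable as a parametrised
    integral; by symmetry it is also the mean over the first.\<close>
  define C where "C y = 1 / volE p m * (\<integral>x. K y x \<partial>\<mu>)" for y
  have Ksym: "K x y = K y x" if "x \<in> E" "y \<in> E" for x y
    using sym Green_sym that by (simp add: K_def)
  have K [measurable]: "(\<lambda>z. K (fst z) (snd z)) \<in> borel_measurable (\<mu> \<Otimes>\<^sub>M \<mu>)"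
    unfolding K_def using meas measurable_Green by (rule borel_measurable_diff)
  have C [measurable]: "C \<in> borel_measurable \<mu>"
  proof -
    have "case_prod K \<in> borel_measurable (\<mu> \<Otimes>\<^sub>M \<mu>)" using K by (simp add: case_prod_beta')
    then have "(\<lambda>y. \<integral>x. K y x \<partial>\<mu>) \<in> borel_measurable \<mu>"
      by (rule mu.borel_measurable_lebesgue_integral)
    then show ?thesis unfolding C_def[abs_def] by simp
  qed
  have row: "AE x in \<mu>. K y x = C y" if y: "y \<in> E" for y
  proof -
    have "AE x in \<mu>. K x y = 1 / volE p m * (\<integral>x. K x y \<partial>\<mu>)"
    proof (rule AE_const_of_orthogonal)
      fix \<phi> assume \<phi>: "loc_const p m \<phi>"
      have "integrable \<mu> (\<lambda>x. g x y * Dop p m \<phi> x) \<and> (\<integral>x. g x y * Dop p m \<phi> x \<partial>\<mu>)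
          = \<phi> y - (1 / volE p m) * (\<integral>x. \<phi> x \<partial>\<mu>)" if "is_green p m g" for g
        using that y \<phi> unfolding is_green_def by blast
      from this[OF green] this[OF is_green_Green]
      show "integrable \<mu> (\<lambda>x. K x y * Dop p m \<phi> x) \<and> (\<integral>x. K x y * Dop p m \<phi> x \<partial>\<mu>) = 0"
        by (simp add: K_def left_diff_distrib)
    qed
    moreover have "(\<integral>x. K x y \<partial>\<mu>) = (\<integral>x. K y x \<partial>\<mu>)"
      using Ksym y by (intro Bochner_Integration.integral_cong) auto
    ultimately have "AE x in \<mu>. K x y = C y" by (simp add: C_def)
    then show ?thesis
      using AE_space by eventually_elim (use Ksym y in simp)
  qed
  have 1: "AE z in \<mu> \<Otimes>\<^sub>M \<mu>. K (fst z) (snd z) = C (fst z)"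
  proof (subst mu_pair.AE_pair_iff[symmetric])
    show "AE x in \<mu>. AE y in \<mu>. K x y = C x"
    proof (rule AE_I2)
      fix x assume "x \<in> space \<mu>"
      then show "AE y in \<mu>. K x y = C x" using row[of x] by simp
    qed
  qed measurable
  have 2: "AE z in \<mu> \<Otimes>\<^sub>M \<mu>. K (fst z) (snd z) = C (snd z)"
  proof (subst mu_pair.AE_pair_iff[symmetric])
    have sets: "{z \<in> space (\<mu> \<Otimes>\<^sub>M \<mu>). K (fst z) (snd z) = C (snd z)} \<in> sets (\<mu> \<Otimes>\<^sub>M \<mu>)"
      by measurable
    have "AE y in \<mu>. AE x in \<mu>. K x y = C y"
    proof (rule AE_I2)
      fix y assume "y \<in> space \<mu>"
      then have y: "y \<in> E" by simp
      show "AE x in \<mu>. K x y = C y"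
        using row[OF y] AE_space by eventually_elim (use Ksym y in simp)
    qed
    then show "AE x in \<mu>. AE y in \<mu>. K x y = C y"
      by (rule mu_pair.AE_commute[OF sets, THEN iffD2])
  qed measurable
  have "AE z in \<mu> \<Otimes>\<^sub>M \<mu>. C (fst z) = C (snd z)"
    using 1 2 by eventually_elim simp
  from mu_pair.AE_pair[OF this] have "AE x in \<mu>. AE y in \<mu>. C x = C y"
    by simp
  \<comment> \<open>Almost every point qualifies and E has positive volume, so one exists; its value
    C x0 is the additive constant.\<close>
  then obtain x0 where x0: "AE y in \<mu>. C x0 = C y" using AE_nonempty by blast
  have "AE z in \<mu> \<Otimes>\<^sub>M \<mu>. C x0 = C (snd z)"
  proof (subst mu_pair.AE_pair_iff[symmetric])
    show "AE x in \<mu>. AE y in \<mu>. C x0 = C y" by (rule AE_I2) (rule x0)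
  qed measurable
  with 2 have "AE z in \<mu> \<Otimes>\<^sub>M \<mu>. G' (fst z) (snd z) = Green p m (fst z) (snd z) + C x0"
    by eventually_elim (simp add: K_def)
  then show ?thesis by blast
qed

end

theorem mainTheorem1:
  fixes p m :: nat
  assumes "prime p" and "m \<ge> 1"
  shows "(\<forall>x\<in>Edom p m. \<forall>y\<in>Edom p m. Green p m x y = Green p m y x)
       \<and> is_green p m (Green p m)
       \<and> (\<forall>G'. (\<forall>x\<in>Edom p m. \<forall>y\<in>Edom p m. G' x y = G' y x)
              \<and> (\<lambda>z. G' (fst z) (snd z)) \<in> borel_measurable (mstar p m \<Otimes>\<^sub>M mstar p m)
              \<and> is_green p m G'
           \<longrightarrow> (\<exists>c. AE z in mstar p m \<Otimes>\<^sub>M mstar p m.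
                     G' (fst z) (snd z) = Green p m (fst z) (snd z) + c))"
proof -
  interpret tate p m using assms by unfold_locales
  show ?thesis using Green_sym is_green_Green Green_unique by blast
qed

end
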